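(* For sub-space-times, every one of the following four relations between the Alexandrov topology $\mathscr{A}$ and the manifold topology $\tau$ occurs: there exist sub-space-times $(M,D,g,T)$ with (1) $\tau=\mathscr{A}$; there exist sub-space-times with (2) $\mathscr{A}\subsetneq\tau$; there exist sub-space-times with (3) $\tau\subsetneq\mathscr{A}$; and there exist sub-space-times with (4) $\tau\not\subset\mathscr{A}$ and $\mathscr{A}\not\subset\tau$.
   Context: A sub-space-time is a quadruple $(M,D,g,T)$ where $M$ is a connected smooth manifold, $D$ is a smooth bracket-generating distribution on $M$ of rank $k$ with $2\le k<\dim M$, $g$ is a smoothly varying non-degenerate symmetric bilinear form on the fibres $D_p$ of index $1$, and $T$ is a globally defined smooth horizontal vector field with $g(T,T)<0$ (the time orientation). A horizontal curve is an absolutely continuous curve $\gamma$ with $\dot\gamma(t)\in D_{\gamma(t)}$ for almost all $t$ and $\dot\gamma$ locally square integrable with respect to an auxiliary Riemannian metric. A horizontal curve is timelike future directed (t.f.d.) if almost everywhere $g(\dot\gamma,\dot\gamma)<0$ and $g(T,\dot\gamma)<0$. Write $p\ll q$ if there is a horizontal t.f.d. curve from $p$ to $q$, and set $I^+(p)=\{q: p\ll q\}$, $I^-(p)=\{q: q\ll p\}$. The Alexandrov topology $\mathscr{A}$ on $M$ is the topology generated by the subbasis $\{I^+(p),I^-(p): p\in M\}$; $\tau$ denotes the given manifold topology of $M$. *)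

theory Defs
  imports "HOL-Analysis.Analysis"
begin

fun Ck_on :: "nat \<Rightarrow> 'a::euclidean_space set \<Rightarrow> ('a \<Rightarrow> 'b::real_normed_vector) \<Rightarrow> bool" where
  "Ck_on 0 U f = continuous_on U f"
| "Ck_on (Suc k) U f =
     (f differentiable_on U \<and> (\<forall>i\<in>Basis. Ck_on k U (\<lambda>x. frechet_derivative f (at x) i)))"

definition smooth_on :: "'a::euclidean_space set \<Rightarrow> ('a \<Rightarrow> 'b::real_normed_vector) \<Rightarrow> bool" where
  "smooth_on U f \<longleftrightarrow> open U \<and> (\<forall>k. Ck_on k U f)"

definition smooth_on_set :: "'a::euclidean_space set \<Rightarrow> ('a \<Rightarrow> 'b::real_normed_vector) \<Rightarrow> bool" where
  "smooth_on_set S f \<longleftrightarrow>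
     (\<forall>p\<in>S. \<exists>U h. p \<in> U \<and> smooth_on U h \<and> (\<forall>x\<in>S \<inter> U. h x = f x))"

definition diffeo_between :: "'a::euclidean_space set \<Rightarrow> 'a set \<Rightarrow> ('a \<Rightarrow> 'a) \<Rightarrow> bool" where
  "diffeo_between U V \<phi> \<longleftrightarrow>
     (\<exists>\<psi>. smooth_on U \<phi> \<and> smooth_on V \<psi> \<and> \<phi> ` U = V \<and>
          (\<forall>x\<in>U. \<psi> (\<phi> x) = x) \<and> (\<forall>y\<in>V. \<phi> (\<psi> y) = y))"

definition embedded_submanifold :: "nat \<Rightarrow> 'a::euclidean_space set \<Rightarrow> bool" where
  "embedded_submanifold n M \<longleftrightarrow>
     (\<forall>p\<in>M. \<exists>U V \<phi> L. p \<in> U \<and> diffeo_between U V \<phi> \<and>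
        subspace L \<and> dim L = n \<and> \<phi> ` (M \<inter> U) = V \<inter> L)"

definition tangent_space :: "'a::euclidean_space set \<Rightarrow> 'a \<Rightarrow> 'a set" where
  "tangent_space M p =
     {v. \<exists>\<gamma>::real \<Rightarrow> 'a. (\<forall>t. \<gamma> t \<in> M) \<and> \<gamma> 0 = p \<and> (\<gamma> has_vector_derivative v) (at 0)}"

definition smooth_distribution :: "'a::euclidean_space set \<Rightarrow> nat \<Rightarrow> ('a \<Rightarrow> 'a set) \<Rightarrow> bool" where
  "smooth_distribution M k D \<longleftrightarrow>
     (\<forall>p\<in>M. subspace (D p) \<and> dim (D p) = k \<and> D p \<subseteq> tangent_space M p) \<and>
     (\<forall>p\<in>M. \<exists>U X. p \<in> U \<and> (\<forall>i<k. smooth_on U (X i)) \<and>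
        (\<forall>q\<in>M \<inter> U. D q = span ((\<lambda>i. X i q) ` {..<k})))"

definition horizontal_field :: "'a::euclidean_space set \<Rightarrow> ('a \<Rightarrow> 'a set) \<Rightarrow> 'a set \<Rightarrow> ('a \<Rightarrow> 'a) \<Rightarrow> bool" where
  "horizontal_field M D U X \<longleftrightarrow> smooth_on U X \<and> (\<forall>q\<in>M \<inter> U. X q \<in> D q)"

definition lie_bracket :: "('a::euclidean_space \<Rightarrow> 'a) \<Rightarrow> ('a \<Rightarrow> 'a) \<Rightarrow> 'a \<Rightarrow> 'a" where
  "lie_bracket X Y x = frechet_derivative Y (at x) (X x) - frechet_derivative X (at x) (Y x)"

inductive_set iterated_brackets ::
  "'a::euclidean_space set \<Rightarrow> ('a \<Rightarrow> 'a set) \<Rightarrow> 'a set \<Rightarrow> ('a \<Rightarrow> 'a) set"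
  for M D U where
  base: "horizontal_field M D U X \<Longrightarrow> X \<in> iterated_brackets M D U"
| bracket: "X \<in> iterated_brackets M D U \<Longrightarrow> Y \<in> iterated_brackets M D U \<Longrightarrow>
            lie_bracket X Y \<in> iterated_brackets M D U"

definition bracket_generating :: "'a::euclidean_space set \<Rightarrow> ('a \<Rightarrow> 'a set) \<Rightarrow> bool" where
  "bracket_generating M D \<longleftrightarrow>
     (\<forall>p\<in>M. \<exists>U. open U \<and> p \<in> U \<and>
        span ((\<lambda>Z. Z p) ` iterated_brackets M D U) = tangent_space M p)"

definition neg_definite_on :: "('a::real_vector \<Rightarrow> 'a \<Rightarrow> real) \<Rightarrow> 'a set \<Rightarrow> bool" where
  "neg_definite_on b W \<longleftrightarrow> (\<forall>w\<in>W. w \<noteq> 0 \<longrightarrow> b w w < 0)"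

definition lorentzian_form_on :: "('a::euclidean_space \<Rightarrow> 'a \<Rightarrow> real) \<Rightarrow> 'a set \<Rightarrow> bool" where
  "lorentzian_form_on b V \<longleftrightarrow>
     (\<forall>u\<in>V. \<forall>v\<in>V. \<forall>w\<in>V. \<forall>r s::real.
         b (r *\<^sub>R u + s *\<^sub>R v) w = r * b u w + s * b v w) \<and>
     (\<forall>u\<in>V. \<forall>v\<in>V. b u v = b v u) \<and>
     (\<forall>u\<in>V. (\<forall>v\<in>V. b u v = 0) \<longrightarrow> u = 0) \<and>
     (\<exists>W. subspace W \<and> W \<subseteq> V \<and> dim W = 1 \<and> neg_definite_on b W) \<and>
     (\<forall>W. subspace W \<and> W \<subseteq> V \<and> neg_definite_on b W \<longrightarrow> dim W \<le> 1)"

definition sub_lorentzian_metric ::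
  "'a::euclidean_space set \<Rightarrow> ('a \<Rightarrow> 'a set) \<Rightarrow> ('a \<Rightarrow> 'a \<Rightarrow> 'a \<Rightarrow> real) \<Rightarrow> bool" where
  "sub_lorentzian_metric M D g \<longleftrightarrow>
     (\<forall>p\<in>M. lorentzian_form_on (g p) (D p)) \<and>
     (\<forall>U X Y. horizontal_field M D U X \<and> horizontal_field M D U Y \<longrightarrow>
        smooth_on_set (M \<inter> U) (\<lambda>q. g q (X q) (Y q)))"

definition sub_spacetime ::
  "'a::euclidean_space set \<Rightarrow> ('a \<Rightarrow> 'a set) \<Rightarrow> ('a \<Rightarrow> 'a \<Rightarrow> 'a \<Rightarrow> real) \<Rightarrow> ('a \<Rightarrow> 'a) \<Rightarrow> bool" where
  "sub_spacetime M D g T \<longleftrightarrow>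
     M \<noteq> {} \<and> connected M \<and>
     (\<exists>n k. embedded_submanifold n M \<and> 2 \<le> k \<and> k < n \<and> smooth_distribution M k D) \<and>
     bracket_generating M D \<and>
     sub_lorentzian_metric M D g \<and>
     smooth_on_set M T \<and> (\<forall>p\<in>M. T p \<in> D p \<and> g p (T p) (T p) < 0)"

text \<open>Horizontal timelike future directed curve from p to q, parametrised on [a,b], a < b.
  An absolutely continuous curve with square-integrable derivative is written as
  gamma t = gamma a + integral of v over [a,t] with v square integrable (v = gamma' a.e.).\<close>
definition htfd_curve ::
  "'a::euclidean_space set \<Rightarrow> ('a \<Rightarrow> 'a set) \<Rightarrow> ('a \<Rightarrow> 'a \<Rightarrow> 'a \<Rightarrow> real) \<Rightarrow> ('a \<Rightarrow> 'a)
   \<Rightarrow> real \<Rightarrow> real \<Rightarrow> (real \<Rightarrow> 'a) \<Rightarrow> bool" where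
  "htfd_curve M D g T a b \<gamma> \<longleftrightarrow> a < b \<and> \<gamma> ` {a..b} \<subseteq> M \<and>
     (\<exists>v. v absolutely_integrable_on {a..b} \<and>
          (\<lambda>t. (norm (v t))\<^sup>2) integrable_on {a..b} \<and>
          (\<forall>t\<in>{a..b}. \<gamma> t = \<gamma> a + integral {a..t} v) \<and>
          (AE t in lborel. t \<in> {a..b} \<longrightarrow>
             v t \<in> D (\<gamma> t) \<and> g (\<gamma> t) (v t) (v t) < 0 \<and> g (\<gamma> t) (T (\<gamma> t)) (v t) < 0))"

definition chron ::
  "'a::euclidean_space set \<Rightarrow> ('a \<Rightarrow> 'a set) \<Rightarrow> ('a \<Rightarrow> 'a \<Rightarrow> 'a \<Rightarrow> real) \<Rightarrow> ('a \<Rightarrow> 'a)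
   \<Rightarrow> 'a \<Rightarrow> 'a \<Rightarrow> bool" where
  "chron M D g T p q \<longleftrightarrow> (\<exists>a b \<gamma>. htfd_curve M D g T a b \<gamma> \<and> \<gamma> a = p \<and> \<gamma> b = q)"

definition I_plus where "I_plus M D g T p = {q. chron M D g T p q}"
definition I_minus where "I_minus M D g T p = {q. chron M D g T q p}"

text \<open>Alexandrov topology on M: generated by the subbasis of all I+(p), I-(p)
  (M itself is open by convention of a topology on M).\<close>
definition alexandrov_topology ::
  "'a::euclidean_space set \<Rightarrow> ('a \<Rightarrow> 'a set) \<Rightarrow> ('a \<Rightarrow> 'a \<Rightarrow> 'a \<Rightarrow> real) \<Rightarrow> ('a \<Rightarrow> 'a)
   \<Rightarrow> 'a topology" where
  "alexandrov_topology M D g T =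
     topology_generated_by (insert M ((I_plus M D g T ` M) \<union> (I_minus M D g T ` M)))"

type_synonym ambient = "real^10"

end

theory Submission
  imports Defs
begin

text \<open>
  All four examples are rank two structures on an open subset of three-space, spanned by fields
  $R$ and $Y$ with $[R, Y] = R(f)\,\partial_z$, and with $R$ and $Y$ null: a horizontal curve is timelike
  future directed iff its $R$- and its $Y$-component are both positive, and $\dot z$ is $f$ times the
  $Y$-component. If $R(s) = 1$, then $f = s$ and $f = s^2$ are both bracket generating.

  On the plane, $f = x$ is the Heisenberg case: the future of a point is an explicit open set and
  diamonds are small, so the topologies agree. With $f = (x - y)^2$ diamonds are still small, but the
  height never decreases, while the timelike line $x = y$ keeps it constant; so futures are not
  open. On the punctured plane with polar coordinates $(e^\sigma, \theta)$ a timelike curve may turn around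
  the origin. With $f = \sigma$ it can gain or lose height while doing so, and any two points are
  joined. With $f = \sigma^2$ futures are not open, by the same argument as before, and the circle
  $\sigma = 0$ is a closed timelike curve, whose points the Alexandrov topology cannot separate.
\<close>

section \<open>Smooth functions\<close>

text \<open>The choice of s is dictated by the examples with f = s^2. There [R, Y] = 2 s d/dz
  vanishes on s = 0, and only [R, [R, Y]] = 2 d/dz makes the structure bracket generating. The
  argument against open futures needs a timelike curve that stays inside s = 0, so this set has to
  be tangent to a timelike direction such as R + Y. In the plane this excludes s = x, whose zero set
  is tangent to no horizontal direction but the null one of Y, and suggests s = x - y. On the
  punctured plane the logarithm of the radius does the same, since R + Y is purely angular.

  One verification serves all cases because the projected frames commute: they are 1 and i, or (1 +
  i) w and i (1 + i) w.

  Curves are only absolutely continuous. Hence every statement that restricts causal relations is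
  obtained by integrating inequalities that hold almost everywhere, whereas existence is settled by
  explicit continuously differentiable curves.\<close>

lemma Ck_on_Suc_iff:
  assumes "open U" "\<And>x. x \<in> U \<Longrightarrow> (f has_derivative f' x) (at x)"
  shows "Ck_on (Suc k) U f \<longleftrightarrow> (\<forall>i\<in>Basis. Ck_on k U (\<lambda>x. frechet_derivative f (at x) i))"
proof -
  have "f differentiable_on U"
    using assms by (meson differentiableI differentiable_at_imp_differentiable_on)
  then show ?thesis by simp
qed

lemma Ck_on_cong:
  assumes "open U" "\<And>x. x \<in> U \<Longrightarrow> f x = g x"
  shows "Ck_on k U f \<longleftrightarrow> Ck_on k U g"
  using assms
proof (induction k arbitrary: f g)
  case 0
  then show ?case by (simp cong: continuous_on_cong)
next
  case (Suc k)
  have d: "h differentiable_on U" if "k' differentiable_on U" "\<And>x. x \<in> U \<Longrightarrow> k' x = h x" for h k' :: "'a \<Rightarrow> 'b"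
    using that unfolding differentiable_on_def
    by (metis differentiable_transform_within zero_less_one)
  have "f differentiable_on U \<longleftrightarrow> g differentiable_on U"
    using d[of f g] d[of g f] Suc.prems by auto
  moreover have "Ck_on k U (\<lambda>x. frechet_derivative f (at x) i) \<longleftrightarrow>
      Ck_on k U (\<lambda>x. frechet_derivative g (at x) i)" if "f differentiable_on U" for i
  proof (rule Suc.IH[OF Suc.prems(1)])
    fix x assume "x \<in> U"
    then have "f differentiable (at x)"
      using that Suc.prems(1) differentiable_on_eq_differentiable_at by blast
    then show "frechet_derivative f (at x) i = frechet_derivative g (at x) i"
      using frechet_derivative_transform_within_open[of f x U g] Suc.prems \<open>x \<in> U\<close> by auto
  qed
  ultimately show ?case by auto
qed

text \<open>The working form of the recursion: a derivative known by formula may replace the chosen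
  Frechet derivative, since the two agree on the open set.\<close>

lemma Ck_on_SucI:
  assumes "open U" "\<And>x. x \<in> U \<Longrightarrow> (f has_derivative f' x) (at x)"
    and "\<And>i. i \<in> Basis \<Longrightarrow> Ck_on k U (\<lambda>x. f' x i)"
  shows "Ck_on (Suc k) U f"
proof -
  have "Ck_on k U (\<lambda>x. frechet_derivative f (at x) i)" if "i \<in> Basis" for i
    using Ck_on_cong[OF assms(1), of "\<lambda>x. f' x i" "\<lambda>x. frechet_derivative f (at x) i" k] assms that
      frechet_derivative_at by metis
  then show ?thesis using Ck_on_Suc_iff[OF assms(1,2)] by blast
qed

lemma Ck_on_SucD: "Ck_on (Suc k) U f \<Longrightarrow> Ck_on k U f"
proof (induction k arbitrary: f)
  case 0
  then show ?case by (simp add: differentiable_imp_continuous_on)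
next
  case (Suc k)
  from Suc.prems have "f differentiable_on U"
    and "\<And>i. i \<in> Basis \<Longrightarrow> Ck_on (Suc k) U (\<lambda>x. frechet_derivative f (at x) i)"
    unfolding Ck_on.simps(2)[of "Suc k"] by blast+
  then show ?case using Suc.IH by simp
qed

lemma Ck_on_Suc_has_derivative:
  assumes "open U" "Ck_on (Suc k) U f" "x \<in> U"
  shows "(f has_derivative frechet_derivative f (at x)) (at x)"
  using assms differentiable_on_eq_differentiable_at frechet_derivative_works
  by (metis Ck_on.simps(2))

lemma smooth_on_Ck: "smooth_on U f \<Longrightarrow> Ck_on k U f"
  by (simp add: smooth_on_def)

lemma smooth_on_open: "smooth_on U f \<Longrightarrow> open U"
  by (simp add: smooth_on_def)

lemma smooth_on_has_derivative:
  assumes "smooth_on U f" "x \<in> U"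
  shows "(f has_derivative frechet_derivative f (at x)) (at x)"
  using assms Ck_on_Suc_has_derivative[of U 0 f x] unfolding smooth_on_def by blast

lemma smooth_on_partial_derivative:
  assumes "smooth_on U f" "i \<in> Basis"
  shows "smooth_on U (\<lambda>x. frechet_derivative f (at x) i)"
  using assms Ck_on.simps(2) unfolding smooth_on_def by blast

lemma smooth_on_cong:
  assumes "smooth_on U f" "\<And>x. x \<in> U \<Longrightarrow> f x = g x"
  shows "smooth_on U g"
  using assms Ck_on_cong unfolding smooth_on_def by blast

lemma Ck_on_const:
  assumes "open U" shows "Ck_on k U (\<lambda>x. c)"
  using assms by (induction k arbitrary: c) (auto simp: continuous_on_const)

lemma smooth_on_const: "open U \<Longrightarrow> smooth_on U (\<lambda>x. c)"
  by (simp add: smooth_on_def Ck_on_const)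

lemma smooth_on_bounded_linear:
  assumes "open U" "bounded_linear f"
  shows "smooth_on U f"
proof -
  have "Ck_on k U f" for k
  proof (cases k)
    case 0
    then show ?thesis using assms(2) linear_continuous_on by simp blast
  next
    case (Suc n)
    show ?thesis unfolding Suc
      using assms bounded_linear_imp_has_derivative[OF assms(2)]
      by (intro Ck_on_SucI[where f'="\<lambda>x. f"]) (auto intro: Ck_on_const)
  qed
  then show ?thesis using assms(1) smooth_on_def by blast
qed

lemma Ck_on_add:
  assumes "open U" "Ck_on k U f" "Ck_on k U g"
  shows "Ck_on k U (\<lambda>x. f x + g x)"
  using assms(2,3)
proof (induction k arbitrary: f g)
  case 0
  then show ?case by (simp add: continuous_on_add)
next
  case (Suc k)
  show ?case
    using Suc.prems assms(1) Ck_on_Suc_has_derivative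
    by (intro Ck_on_SucI[where f'="\<lambda>x h. frechet_derivative f (at x) h + frechet_derivative g (at x) h"]
        Suc.IH has_derivative_add) simp_all
qed

text \<open>Induction through the Leibniz rule. Each summand pairs a derivative with an
  undifferentiated factor, which is why \<open>Ck_on_SucD\<close> is needed.\<close>

lemma (in bounded_bilinear) Ck_on:
  assumes "open U" "Ck_on k U f" "Ck_on k U g"
  shows "Ck_on k U (\<lambda>x. prod (f x) (g x))"
  using assms(2,3)
proof (induction k arbitrary: f g)
  case 0
  then show ?case by (simp add: continuous_on)
next
  case (Suc k)
  show ?case
  proof (rule Ck_on_SucI[OF assms(1)])
    show "((\<lambda>x. prod (f x) (g x)) has_derivative
        (\<lambda>h. prod (f x) (frechet_derivative g (at x) h) + prod (frechet_derivative f (at x) h) (g x))) (at x)"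
      if "x \<in> U" for x
      by (intro FDERIV Ck_on_Suc_has_derivative[OF assms(1) Suc.prems(1) that]
          Ck_on_Suc_has_derivative[OF assms(1) Suc.prems(2) that])
    fix i :: 'd assume "i \<in> Basis"
    with Suc.prems show "Ck_on k U (\<lambda>x. prod (f x) (frechet_derivative g (at x) i)
        + prod (frechet_derivative f (at x) i) (g x))"
      by (intro Ck_on_add assms(1) Suc.IH Ck_on_SucD[of k U f] Ck_on_SucD[of k U g]) auto
  qed
qed

lemma smooth_on_add: "smooth_on U f \<Longrightarrow> smooth_on U g \<Longrightarrow> smooth_on U (\<lambda>x. f x + g x)"
  by (simp add: smooth_on_def Ck_on_add)

lemma (in bounded_bilinear) smooth_on:
  "smooth_on U f \<Longrightarrow> smooth_on U g \<Longrightarrow> smooth_on U (\<lambda>x. prod (f x) (g x))"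
  by (simp add: smooth_on_def Ck_on)

lemmas smooth_on_scaleR = bounded_bilinear.smooth_on[OF bounded_bilinear_scaleR]
lemmas smooth_on_mult = bounded_bilinear.smooth_on[OF bounded_bilinear_mult]
lemmas smooth_on_inner = bounded_bilinear.smooth_on[OF bounded_bilinear_inner]

lemma smooth_on_minus: "smooth_on U f \<Longrightarrow> smooth_on U (\<lambda>x. - f x)"
  using smooth_on_scaleR[OF smooth_on_const[of U "-1"], of f] smooth_on_open[of U f] by simp

lemma smooth_on_diff: "smooth_on U f \<Longrightarrow> smooth_on U g \<Longrightarrow> smooth_on U (\<lambda>x. f x - g x)"
  using smooth_on_add[of U f "\<lambda>x. - g x"] smooth_on_minus[of U g] by simp

lemma smooth_on_power2: "smooth_on U f \<Longrightarrow> smooth_on U (\<lambda>x. (f x :: real)\<^sup>2)"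
  by (simp add: power2_eq_square smooth_on_mult)

lemma smooth_on_sum:
  assumes "open U" "\<And>i. i \<in> I \<Longrightarrow> smooth_on U (f i)"
  shows "smooth_on U (\<lambda>x. \<Sum>i\<in>I. f i x)"
  using assms(2)
proof (induction I rule: infinite_finite_induct)
  case (insert j J)
  then show ?case using smooth_on_add[of U "f j"] by simp
qed (simp_all add: assms(1) smooth_on_const)

lemma smooth_on_nth:
  fixes f :: "'a::euclidean_space \<Rightarrow> real ^ 'n"
  assumes "smooth_on U f"
  shows "smooth_on U (\<lambda>x. f x $ i)"
  using smooth_on_inner[OF assms smooth_on_const[OF smooth_on_open[OF assms], of "axis i 1"]]
  by (simp add: inner_axis)

lemma smooth_on_component:
  fixes U :: "(real ^ 'n) set"
  shows "open U \<Longrightarrow> smooth_on U (\<lambda>x. x $ i)"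
  by (simp add: smooth_on_bounded_linear bounded_linear_vec_nth)

text \<open>The derivative of 1/f is again built from 1/f and a partial derivative of f, so the
  induction on the order closes.\<close>

lemma smooth_on_inverse:
  fixes f :: "'a::euclidean_space \<Rightarrow> real"
  assumes "smooth_on U f" "\<And>x. x \<in> U \<Longrightarrow> f x \<noteq> 0"
  shows "smooth_on U (\<lambda>x. inverse (f x))"
proof -
  have U: "open U" using assms(1) by (rule smooth_on_open)
  have "Ck_on k U (\<lambda>x. inverse (f x))" for k
  proof (induction k)
    case 0
    have "continuous_on U f" using assms(1) smooth_on_Ck[of U f 0] by simp
    then show ?case using assms(2) by (auto intro!: continuous_on_inverse)
  next
    case (Suc k)
    show ?case
    proof (rule Ck_on_SucI[OF U])
      show "((\<lambda>x. inverse (f x)) has_derivative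
          (\<lambda>h. - (inverse (f x) * frechet_derivative f (at x) h * inverse (f x)))) (at x)"
        if "x \<in> U" for x
        using smooth_on_has_derivative[OF assms(1) that] assms(2)[OF that]
        by (intro Deriv.has_derivative_inverse) auto
      fix i :: 'a assume "i \<in> Basis"
      then have "Ck_on k U (\<lambda>x. frechet_derivative f (at x) i)"
        using assms(1) smooth_on_Ck smooth_on_partial_derivative by blast
      then have "Ck_on k U (\<lambda>x. (- 1) *\<^sub>R (inverse (f x) * frechet_derivative f (at x) i * inverse (f x)))"
        by (intro bounded_bilinear.Ck_on[OF bounded_bilinear_mult U]
            bounded_bilinear.Ck_on[OF bounded_bilinear_scaleR U] Ck_on_const U Suc.IH)
      then show "Ck_on k U (\<lambda>x. - (inverse (f x) * frechet_derivative f (at x) i * inverse (f x)))"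
        by simp
    qed
  qed
  then show ?thesis using U smooth_on_def by blast
qed

lemma smooth_on_ln:
  fixes f :: "'a::euclidean_space \<Rightarrow> real"
  assumes "smooth_on U f" "\<And>x. x \<in> U \<Longrightarrow> f x > 0"
  shows "smooth_on U (\<lambda>x. ln (f x))"
proof -
  have U: "open U" using assms(1) by (rule smooth_on_open)
  have nz: "f x \<noteq> 0" if "x \<in> U" for x using assms(2)[OF that] by simp
  have "Ck_on k U (\<lambda>x. ln (f x))" for k
  proof (cases k)
    case 0
    have "continuous_on U f" using assms(1) smooth_on_Ck[of U f 0] by simp
    then show ?thesis using assms(2) 0 by (force intro!: continuous_on_ln)
  next
    case (Suc n)
    show ?thesis unfolding Suc
    proof (rule Ck_on_SucI[OF U])
      show "((\<lambda>x. ln (f x)) has_derivative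
          (\<lambda>h. frechet_derivative f (at x) h * inverse (f x))) (at x)" if "x \<in> U" for x
        by (rule derivative_eq_intros smooth_on_has_derivative[OF assms(1) that] assms(2)[OF that]
            | simp add: field_simps)+
      fix i :: 'a assume "i \<in> Basis"
      then show "Ck_on n U (\<lambda>x. frechet_derivative f (at x) i * inverse (f x))"
        using nz
        by (intro smooth_on_Ck smooth_on_mult smooth_on_partial_derivative smooth_on_inverse assms(1))
    qed
  qed
  then show ?thesis using U smooth_on_def by blast
qed

lemma smooth_on_lie_bracket:
  assumes "smooth_on U X" "smooth_on U Y"
  shows "smooth_on U (lie_bracket X Y)"
proof -
  have U: "open U" using assms(1) by (rule smooth_on_open)
  have D: "smooth_on U (\<lambda>x. frechet_derivative F (at x) (G x))"
    if F: "smooth_on U F" and G: "smooth_on U G" for F G :: "'a \<Rightarrow> 'a"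
  proof (rule smooth_on_cong)
    \<comment> \<open>Smoothness controls derivatives only along fixed basis vectors; linearity
      reduces the derivative along the variable vector \<open>G x\<close> to these.\<close>
    show "smooth_on U (\<lambda>x. \<Sum>i\<in>Basis. (G x \<bullet> i) *\<^sub>R frechet_derivative F (at x) i)"
      by (intro smooth_on_sum U smooth_on_scaleR smooth_on_inner smooth_on_const
          smooth_on_partial_derivative F G)
    fix x assume "x \<in> U"
    then have l: "linear (frechet_derivative F (at x))"
      using smooth_on_has_derivative[OF F] has_derivative_linear by blast
    have "frechet_derivative F (at x) (G x) =
        frechet_derivative F (at x) (\<Sum>i\<in>Basis. (G x \<bullet> i) *\<^sub>R i)"
      by (simp add: euclidean_representation)
    then show "(\<Sum>i\<in>Basis. (G x \<bullet> i) *\<^sub>R frechet_derivative F (at x) i) =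
        frechet_derivative F (at x) (G x)"
      by (simp add: linear_sum[OF l] linear_cmul[OF l] o_def)
  qed
  show ?thesis unfolding lie_bracket_def
    by (intro smooth_on_diff D assms)
qed

section \<open>Curves and the Alexandrov topology\<close>

lemma AE_lborel_negligible:
  assumes "AE t in lborel. P t"
  obtains N where "negligible N" "\<And>t. t \<notin> N \<Longrightarrow> P t"
proof -
  have "AE t in lebesgue. P t" using assms by (rule AE_completion)
  then show ?thesis using that unfolding eventually_ae_filter_negligible by auto
qed

lemma integral_nonneg_AE_lborel:
  fixes f :: "real \<Rightarrow> real"
  assumes "AE t in lborel. t \<in> {a..b} \<longrightarrow> 0 \<le> f t"
  shows "0 \<le> integral {a..b} f"
proof -
  obtain N where N: "negligible N" "\<And>t. t \<notin> N \<Longrightarrow> t \<in> {a..b} \<longrightarrow> 0 \<le> f t"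
    using AE_lborel_negligible[OF assms] by blast
  have "integral {a..b} f = integral {a..b} (\<lambda>t. if t \<in> N then 0 else f t)"
    by (rule integral_spike[OF N(1)]) auto
  \<comment> \<open>No integrability is assumed: a function that is not integrable has integral 0 by
    convention.\<close>
  also have "\<dots> \<ge> 0"
    by (cases "(\<lambda>t. if t \<in> N then 0 else f t) integrable_on {a..b}")
      (auto intro!: integral_nonneg simp: N(2) not_integrable_integral)
  finally show ?thesis .
qed

lemma integral_pos_AE_lborel:
  fixes f :: "real \<Rightarrow> real"
  assumes "a < b" "f integrable_on {a..b}" "AE t in lborel. t \<in> {a..b} \<longrightarrow> 0 < f t"
  shows "0 < integral {a..b} f"
proof (rule ccontr)
  obtain N where N: "negligible N" "\<And>t. t \<notin> N \<Longrightarrow> t \<in> {a..b} \<longrightarrow> 0 < f t"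
    using AE_lborel_negligible[OF assms(3)] by blast
  \<comment> \<open>Changing f on the null set makes it positive at every point of the interval
    without changing the integral.\<close>
  define h where "h t = (if t \<in> N then 1 else f t)" for t
  have h: "0 < h t" if "t \<in> {a..b}" for t using N(2) that by (simp add: h_def)
  have eq: "integral {a..b} f = integral {a..b} h"
    by (rule integral_spike[OF N(1)]) (simp add: h_def)
  have int: "h integrable_on {a..b}"
    by (rule integrable_spike[OF assms(2) N(1)]) (simp add: h_def)
  then have ai: "h absolutely_integrable_on {a..b}"
    using h by (intro nonnegative_absolutely_integrable_1) (auto intro: less_imp_le)
  assume "\<not> 0 < integral {a..b} f"
  moreover have "0 \<le> integral {a..b} h"
    by (rule integral_nonneg[OF int]) (use h in force)
  ultimately have "integral {a..b} h = 0" using eq by simp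
  then have "integral\<^sup>L lebesgue (\<lambda>t. indicator {a..b} t *\<^sub>R h t) = 0"
    using set_lebesgue_integral_eq_integral(2)[OF ai] by (simp add: set_lebesgue_integral_def)
  moreover have "integrable lebesgue (\<lambda>t. indicator {a..b} t *\<^sub>R h t)"
    using ai by (simp add: set_integrable_def)
  moreover have "AE t in lebesgue. 0 \<le> indicator {a..b} t *\<^sub>R h t"
    using h by (auto simp: indicator_def intro: less_imp_le)
  ultimately have "AE t in lebesgue. indicator {a..b} t *\<^sub>R h t = 0"
    using integral_nonneg_eq_0_iff_AE by blast
  then obtain N' where N': "negligible N'" "{t. indicator {a..b} t *\<^sub>R h t \<noteq> 0} \<subseteq> N'"
    unfolding eventually_ae_filter_negligible by auto
  \<comment> \<open>A nonnegative function with integral 0 vanishes almost everywhere, but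
    \<open>h\<close> vanishes nowhere on the interval, so the interval itself would be a null
    set.\<close>
  have "{a..b} \<subseteq> N'" using N'(2) h by (fastforce simp: indicator_def)
  then have "negligible {a..b}" using N'(1) negligible_subset by blast
  then show False using assms(1) negligible_interval(1)[of a b] by (simp add: box_real)
qed

lemma integral_less_AE_lborel:
  fixes f g :: "real \<Rightarrow> real"
  assumes "a < b" "f integrable_on {a..b}" "g integrable_on {a..b}"
    and "AE t in lborel. t \<in> {a..b} \<longrightarrow> f t < g t"
  shows "integral {a..b} f < integral {a..b} g"
proof -
  have "0 < integral {a..b} (\<lambda>t. g t - f t)"
    using assms by (intro integral_pos_AE_lborel integrable_diff) auto
  then show ?thesis using assms by (simp add: integral_diff)
qed

lemma htfd_curve_concat:
  assumes "htfd_curve M D g T a b \<gamma>" "htfd_curve M D g T b c \<delta>" "\<gamma> b = \<delta> b"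
  shows "htfd_curve M D g T a c (\<lambda>t. if t \<le> b then \<gamma> t else \<delta> t)"
proof -
  from assms(1) obtain v where ab: "a < b" "\<gamma> ` {a..b} \<subseteq> M"
    and v: "v absolutely_integrable_on {a..b}" "(\<lambda>t. (norm (v t))\<^sup>2) integrable_on {a..b}"
      "\<And>t. t\<in>{a..b} \<Longrightarrow> \<gamma> t = \<gamma> a + integral {a..t} v"
      "AE t in lborel. t \<in> {a..b} \<longrightarrow>
         v t \<in> D (\<gamma> t) \<and> g (\<gamma> t) (v t) (v t) < 0 \<and> g (\<gamma> t) (T (\<gamma> t)) (v t) < 0"
    unfolding htfd_curve_def by blast
  from assms(2) obtain w where bc: "b < c" "\<delta> ` {b..c} \<subseteq> M"
    and w: "w absolutely_integrable_on {b..c}" "(\<lambda>t. (norm (w t))\<^sup>2) integrable_on {b..c}"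
      "\<And>t. t\<in>{b..c} \<Longrightarrow> \<delta> t = \<delta> b + integral {b..t} w"
      "AE t in lborel. t \<in> {b..c} \<longrightarrow>
         w t \<in> D (\<delta> t) \<and> g (\<delta> t) (w t) (w t) < 0 \<and> g (\<delta> t) (T (\<delta> t)) (w t) < 0"
    unfolding htfd_curve_def by blast
  \<comment> \<open>The value at the joint \<open>b\<close> is irrelevant for the integrals; taking
    \<open>v\<close> there matches the case distinction of the joined curve.\<close>
  define u where "u t = (if t \<le> b then v t else w t)" for t
  have uv: "u t = v t" if "t \<in> {a..b}" for t using that by (simp add: u_def)
  have uw: "u t = w t" if "t \<in> {b..c} - {b}" for t using that by (simp add: u_def)
  have "u absolutely_integrable_on {a..b}"
    using v(1) by (rule absolutely_integrable_spike[of _ _ "{}"]) (auto simp: uv)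
  moreover have "u absolutely_integrable_on {b..c}"
    using w(1) by (rule absolutely_integrable_spike[of _ _ "{b}"]) (auto simp: uw)
  ultimately have u1: "u absolutely_integrable_on {a..c}"
    using ab(1) bc(1) by (intro absolutely_integrable_on_combine[where c=b and f=u and a=a and b=c]) auto
  have "(\<lambda>t. (norm (u t))\<^sup>2) integrable_on {a..b}"
    using v(2) by (rule integrable_spike[of _ _ "{}"]) (auto simp: uv)
  moreover have "(\<lambda>t. (norm (u t))\<^sup>2) integrable_on {b..c}"
    using w(2) by (rule integrable_spike[of _ _ "{b}"]) (auto simp: uw)
  ultimately have u2: "(\<lambda>t. (norm (u t))\<^sup>2) integrable_on {a..c}"
    using ab(1) bc(1) by (intro Henstock_Kurzweil_Integration.integrable_combine[of a b c]) auto
  have iab: "integral {a..t} u = integral {a..t} v" if "t \<in> {a..b}" for t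
    using that by (intro integral_cong) (simp add: uv)
  have u3: "(if t \<le> b then \<gamma> t else \<delta> t) = (if a \<le> b then \<gamma> a else \<delta> a) + integral {a..t} u"
    if t: "t \<in> {a..c}" for t
  proof (cases "t \<le> b")
    case True
    then show ?thesis using v(3)[of t] iab[of t] t ab by simp
  next
    case False
    have "u integrable_on {a..t}"
      using t u1 by (auto simp: absolutely_integrable_on_def intro: integrable_subinterval_real)
    then have "integral {a..b} u + integral {b..t} u = integral {a..t} u"
      using False ab(1) by (intro Henstock_Kurzweil_Integration.integral_combine) auto
    moreover have "integral {b..t} u = integral {b..t} w"
      by (rule integral_spike[of "{b}"]) (use t in \<open>auto simp: u_def\<close>)
    moreover have "\<gamma> b = \<gamma> a + integral {a..b} u" "\<delta> t = \<delta> b + integral {b..t} w"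
      using v(3)[of b] w(3)[of t] iab[of b] t ab(1) False by auto
    ultimately show ?thesis using ab(1) False assms(3) by (simp add: add.assoc[symmetric])
  qed
  have u4: "AE t in lborel. t \<in> {a..c} \<longrightarrow> (let x = if t \<le> b then \<gamma> t else \<delta> t in
         u t \<in> D x \<and> g x (u t) (u t) < 0 \<and> g x (T x) (u t) < 0)"
    using v(4) w(4)
  proof eventually_elim
    case (elim t)
    then show ?case by (cases "t \<le> b") (simp_all add: u_def)
  qed
  have "(\<lambda>t. if t \<le> b then \<gamma> t else \<delta> t) ` {a..c} \<subseteq> M"
    using ab(2) bc(2) by (force simp: image_subset_iff)
  then show ?thesis unfolding htfd_curve_def
    using ab(1) bc(1) u1 u2 u3 u4 unfolding Let_def by (intro conjI exI[of _ u]) (simp_all split del: if_split)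
qed

text \<open>The assumptions say that every subbasic set containing p contains q. This passes to
  finite intersections and to unions, hence to all Alexandrov-open sets.\<close>

lemma openin_alexandrov_imp:
  assumes "openin (alexandrov_topology M D g T) W" "p \<in> W"
    and "p \<in> M \<Longrightarrow> q \<in> M"
    and "\<And>r. r \<in> M \<Longrightarrow> chron M D g T r p \<Longrightarrow> chron M D g T r q"
    and "\<And>r. r \<in> M \<Longrightarrow> chron M D g T p r \<Longrightarrow> chron M D g T q r"
  shows "q \<in> W"
proof -
  have "generate_topology_on (insert M ((I_plus M D g T ` M) \<union> (I_minus M D g T ` M))) W"
    using assms(1) by (simp add: alexandrov_topology_def openin_topology_generated_by_iff)
  then show ?thesis using assms(2)
  proof (induction W rule: generate_topology_on.induct)
    case (Basis S)
    then show ?case using assms(3-5) by (auto simp: I_plus_def I_minus_def)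
  qed auto
qed

lemma alexandrov_not_finer:
  assumes "p \<in> M" "q \<in> M" "p \<noteq> q"
    and "\<And>r. r \<in> M \<Longrightarrow> chron M D g T r p \<Longrightarrow> chron M D g T r q"
    and "\<And>r. r \<in> M \<Longrightarrow> chron M D g T p r \<Longrightarrow> chron M D g T q r"
  shows "\<not> Collect (openin (top_of_set M)) \<subseteq> Collect (openin (alexandrov_topology M D g T))"
proof
  assume *: "Collect (openin (top_of_set M)) \<subseteq> Collect (openin (alexandrov_topology M D g T))"
  \<comment> \<open>The manifold topology separates the two points, so this set contains p but not
    q.\<close>
  have "openin (top_of_set M) (M \<inter> (- {q}))" by (simp add: open_Compl openin_open_Int)
  then have "openin (alexandrov_topology M D g T) (M \<inter> (- {q}))" using * by auto
  from openin_alexandrov_imp[OF this, of p q] assms show False by auto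
qed

lemma alexandrov_coarser:
  assumes "\<And>p. p \<in> M \<Longrightarrow> openin (top_of_set M) (I_plus M D g T p)"
    and "\<And>p. p \<in> M \<Longrightarrow> openin (top_of_set M) (I_minus M D g T p)"
  shows "Collect (openin (alexandrov_topology M D g T)) \<subseteq> Collect (openin (top_of_set M))"
proof
  fix W assume "W \<in> Collect (openin (alexandrov_topology M D g T))"
  then have "generate_topology_on (insert M ((I_plus M D g T ` M) \<union> (I_minus M D g T ` M))) W"
    by (simp add: alexandrov_topology_def openin_topology_generated_by_iff)
  then have "openin (top_of_set M) W"
  proof (induction W rule: generate_topology_on.induct)
    case (Basis S)
    then show ?case using assms by auto
  qed auto
  then show "W \<in> Collect (openin (top_of_set M))" by simp
qed

lemma openin_alexandrov_I_plus:
  "p \<in> M \<Longrightarrow> openin (alexandrov_topology M D g T) (I_plus M D g T p)"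
  unfolding alexandrov_topology_def by (rule topology_generated_by_Basis) simp

lemma openin_alexandrov_I_minus:
  "p \<in> M \<Longrightarrow> openin (alexandrov_topology M D g T) (I_minus M D g T p)"
  unfolding alexandrov_topology_def by (rule topology_generated_by_Basis) simp

lemma chronI:
  "htfd_curve M D g T a b \<gamma> \<Longrightarrow> \<gamma> a = p \<Longrightarrow> \<gamma> b = q \<Longrightarrow> chron M D g T p q"
  unfolding chron_def by blast

lemma chron_in:
  assumes "chron M D g T p q"
  shows "p \<in> M" "q \<in> M"
proof -
  obtain a b \<gamma> where htfd: "htfd_curve M D g T a b \<gamma>" and ends: "\<gamma> a = p" "\<gamma> b = q"
    using assms unfolding chron_def by blast
  have "a < b" "\<gamma> ` {a..b} \<subseteq> M"
    using htfd unfolding htfd_curve_def by simp_all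
  with ends show "p \<in> M" "q \<in> M" by (auto simp: image_subset_iff)
qed

text \<open>The diamond between q and r is Alexandrov-open, so it suffices that each point has
  diamonds around it of arbitrarily small ambient size.\<close>

lemma alexandrov_finer:
  assumes "\<And>p e. p \<in> M \<Longrightarrow> 0 < e \<Longrightarrow> \<exists>q r. chron M D g T q p \<and> chron M D g T p r \<and>
      (\<forall>x. chron M D g T q x \<longrightarrow> chron M D g T x r \<longrightarrow> dist x p < e)"
  shows "Collect (openin (top_of_set M)) \<subseteq> Collect (openin (alexandrov_topology M D g T))"
proof
  fix W assume "W \<in> Collect (openin (top_of_set M))"
  then have W: "W \<subseteq> M" "\<And>x. x \<in> W \<Longrightarrow> \<exists>e>0. \<forall>y\<in>M. dist y x < e \<longrightarrow> y \<in> W"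
    by (auto simp: openin_euclidean_subtopology_iff)
  have "\<exists>S. openin (alexandrov_topology M D g T) S \<and> p \<in> S \<and> S \<subseteq> W" if "p \<in> W" for p
  proof -
    obtain e where e: "e > 0" "\<And>y. y \<in> M \<Longrightarrow> dist y p < e \<Longrightarrow> y \<in> W" using W(2)[OF \<open>p \<in> W\<close>] by blast
    obtain q r where qr: "chron M D g T q p" "chron M D g T p r"
      "\<And>x. chron M D g T q x \<Longrightarrow> chron M D g T x r \<Longrightarrow> dist x p < e"
      using assms[of p e] W(1) \<open>p \<in> W\<close> e(1) by blast
    have "openin (alexandrov_topology M D g T) (I_plus M D g T q \<inter> I_minus M D g T r)"
      using qr chron_in by (intro openin_Int openin_alexandrov_I_plus openin_alexandrov_I_minus) blast+
    moreover have "p \<in> I_plus M D g T q \<inter> I_minus M D g T r"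
      using qr by (simp add: I_plus_def I_minus_def)
    moreover have "I_plus M D g T q \<inter> I_minus M D g T r \<subseteq> W"
      using qr(3) e(2) chron_in(2)[of M D g T q] by (auto simp: I_plus_def I_minus_def)
    ultimately show ?thesis by blast
  qed
  then show "W \<in> Collect (openin (alexandrov_topology M D g T))"
    using openin_subopen by blast
qed

section \<open>The model structures\<close>

text \<open>Three of the ten ambient coordinates carry the examples; each manifold is a relatively
  open part of this subspace.\<close>

definition space3 :: "ambient set" where
  "space3 = {x. \<forall>i. i \<notin> {1, 2, 3} \<longrightarrow> x $ i = 0}"

definition vec3 :: "real \<Rightarrow> real \<Rightarrow> real \<Rightarrow> ambient" where
  "vec3 x y z = x *\<^sub>R axis 1 1 + y *\<^sub>R axis 2 1 + z *\<^sub>R axis 3 1"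

text \<open>The parameter \<open>\<kappa>\<close> is 0 for the plane and 1 for the punctured plane. With \<open>w = x $ 1 + i x $ 2\<close>,
  \<open>frameR\<close> projects to the vector field \<open>frame_re + i frame_im\<close>, which is the constant 1 in the first case and
  \<open>(1 + i) w\<close>, that is, radial plus angular direction, in the second; \<open>frameY\<close> projects to its rotation by
  a right angle.\<close>

definition frame_re :: "real \<Rightarrow> ambient \<Rightarrow> real" where
  "frame_re \<kappa> x = (1 - \<kappa>) + \<kappa> * (x $ 1 - x $ 2)"

definition frame_im :: "real \<Rightarrow> ambient \<Rightarrow> real" where
  "frame_im \<kappa> x = \<kappa> * (x $ 1 + x $ 2)"

definition frame_sq :: "real \<Rightarrow> ambient \<Rightarrow> real" where
  "frame_sq \<kappa> x = (frame_re \<kappa> x)\<^sup>2 + (frame_im \<kappa> x)\<^sup>2"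

text \<open>Open in the whole ambient space, so that frame fields and their brackets can be
  differentiated there. Since \<open>frame_sq\<close> is 1 for \<kappa> = 0 and twice the squared
  planar radius for \<kappa> = 1, only the second case removes anything.\<close>

definition model_dom :: "real \<Rightarrow> ambient set" where
  "model_dom \<kappa> = {x. 0 < frame_sq \<kappa> x}"

definition model :: "real \<Rightarrow> ambient set" where
  "model \<kappa> = space3 \<inter> model_dom \<kappa>"

definition frameR :: "real \<Rightarrow> ambient \<Rightarrow> ambient" where
  "frameR \<kappa> x = vec3 (frame_re \<kappa> x) (frame_im \<kappa> x) 0"

definition frameY :: "real \<Rightarrow> (ambient \<Rightarrow> real) \<Rightarrow> ambient \<Rightarrow> ambient" where
  "frameY \<kappa> f x = vec3 (- frame_im \<kappa> x) (frame_re \<kappa> x) (f x)"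

text \<open>Together with \<open>beta\<close> this is the coframe dual to R and Y on the horizontal
  plane, multiplied by \<open>frame_sq\<close> to avoid division.\<close>

definition alpha :: "real \<Rightarrow> ambient \<Rightarrow> ambient \<Rightarrow> real" where
  "alpha \<kappa> x v = frame_re \<kappa> x * v $ 1 + frame_im \<kappa> x * v $ 2"

definition beta :: "real \<Rightarrow> ambient \<Rightarrow> ambient \<Rightarrow> real" where
  "beta \<kappa> x v = - frame_im \<kappa> x * v $ 1 + frame_re \<kappa> x * v $ 2"

definition model_plane :: "real \<Rightarrow> (ambient \<Rightarrow> real) \<Rightarrow> ambient \<Rightarrow> ambient set" where
  "model_plane \<kappa> f x = span {frameR \<kappa> x, frameY \<kappa> f x}"

definition model_metric :: "real \<Rightarrow> ambient \<Rightarrow> ambient \<Rightarrow> ambient \<Rightarrow> real" where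
  "model_metric \<kappa> x v w = - (alpha \<kappa> x v * beta \<kappa> x w + beta \<kappa> x v * alpha \<kappa> x w)"

definition model_time :: "real \<Rightarrow> (ambient \<Rightarrow> real) \<Rightarrow> ambient \<Rightarrow> ambient" where
  "model_time \<kappa> f x = frameR \<kappa> x + frameY \<kappa> f x"

section \<open>Coordinates of the three-space\<close>

lemma vec3_nth [simp]: "vec3 x y z $ 1 = x" "vec3 x y z $ 2 = y" "vec3 x y z $ 3 = z"
  by (simp_all add: vec3_def axis_def)

lemma vec3_nth_0: "i \<notin> {1, 2, 3} \<Longrightarrow> vec3 x y z $ i = 0"
  by (auto simp: vec3_def axis_def)

lemma vec3_in [simp]: "vec3 x y z \<in> space3"
  by (simp add: space3_def vec3_nth_0)

lemma vec3_eta: "x \<in> space3 \<Longrightarrow> vec3 (x $ 1) (x $ 2) (x $ 3) = x"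
  unfolding vec_eq_iff
proof
  fix i :: 10 assume "x \<in> space3"
  then show "vec3 (x $ 1) (x $ 2) (x $ 3) $ i = x $ i"
    by (cases "i \<in> {1, 2, 3}") (auto simp: space3_def vec3_nth_0)
qed

lemma space3_eqI:
  assumes "x \<in> space3" "y \<in> space3" "x $ 1 = y $ 1" "x $ 2 = y $ 2" "x $ 3 = y $ 3"
  shows "x = y"
  using assms vec3_eta by metis

lemma subspace_space3: "subspace space3"
  by (auto simp: space3_def subspace_def)

lemma vec3_add: "vec3 x y z + vec3 x' y' z' = vec3 (x + x') (y + y') (z + z')"
  by (simp add: vec3_def algebra_simps)

lemma vec3_scaleR: "r *\<^sub>R vec3 x y z = vec3 (r * x) (r * y) (r * z)"
  by (simp add: vec3_def algebra_simps)

lemma vec3_diff: "vec3 x y z - vec3 x' y' z' = vec3 (x - x') (y - y') (z - z')"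
  by (simp add: vec3_def algebra_simps)

lemma dim_space3: "dim space3 = 3"
proof -
  have "dim {x :: ambient. \<forall>i\<in>Basis. i \<notin> (\<lambda>i. axis i 1) ` {1, 2, 3} \<longrightarrow> x \<bullet> i = 0} =
      card ((\<lambda>i. axis i 1 :: ambient) ` {1, 2, 3})"
    by (rule dim_substandard) (auto simp: Basis_vec_def)
  moreover have "{x :: ambient. \<forall>i\<in>Basis. i \<notin> (\<lambda>i. axis i 1) ` {1, 2, 3} \<longrightarrow> x \<bullet> i = 0} = space3"
    by (auto simp: space3_def Basis_vec_def inner_axis axis_eq_axis)
  moreover have "card ((\<lambda>i. axis i 1 :: ambient) ` {1, 2, 3}) = card {1 :: 10, 2, 3}"
    by (rule card_image) (auto simp: inj_on_def axis_eq_axis)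
  ultimately show ?thesis by simp
qed

lemma has_derivative_vec3 [derivative_intros]:
  assumes "(f has_derivative f') F" "(g has_derivative g') F" "(h has_derivative h') F"
  shows "((\<lambda>x. vec3 (f x) (g x) (h x)) has_derivative (\<lambda>v. vec3 (f' v) (g' v) (h' v))) F"
  unfolding vec3_def using assms by (auto intro!: derivative_eq_intros)

lemma smooth_on_vec3:
  "smooth_on U f \<Longrightarrow> smooth_on U g \<Longrightarrow> smooth_on U h \<Longrightarrow>
    smooth_on U (\<lambda>x. vec3 (f x) (g x) (h x))"
  unfolding vec3_def by (intro smooth_on_add smooth_on_scaleR smooth_on_const smooth_on_open)

lemma continuous_on_frame_sq: "continuous_on A (frame_sq \<kappa>)"
  unfolding frame_sq_def frame_re_def frame_im_def by (intro continuous_intros)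

lemma open_model_dom: "open (model_dom \<kappa>)"
  unfolding model_dom_def by (intro open_Collect_less continuous_on_const continuous_on_frame_sq)

lemma smooth_on_frame_re: "open U \<Longrightarrow> smooth_on U (frame_re \<kappa>)"
  unfolding frame_re_def
  by (intro smooth_on_add smooth_on_mult smooth_on_diff smooth_on_const smooth_on_component)

lemma smooth_on_frame_im: "open U \<Longrightarrow> smooth_on U (frame_im \<kappa>)"
  unfolding frame_im_def
  by (intro smooth_on_add smooth_on_mult smooth_on_diff smooth_on_const smooth_on_component)

lemma smooth_on_frameR: "open U \<Longrightarrow> smooth_on U (frameR \<kappa>)"
  unfolding frameR_def by (intro smooth_on_vec3 smooth_on_frame_re smooth_on_frame_im smooth_on_const)

lemma smooth_on_frameY: "smooth_on U f \<Longrightarrow> smooth_on U (frameY \<kappa> f)"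
  unfolding frameY_def
  by (intro smooth_on_vec3 smooth_on_minus smooth_on_frame_re smooth_on_frame_im) (auto dest: smooth_on_open)

lemma model_space3: "x \<in> model \<kappa> \<Longrightarrow> x \<in> space3" and model_frame_sq: "x \<in> model \<kappa> \<Longrightarrow> 0 < frame_sq \<kappa> x"
  and model_in_model_dom: "x \<in> model \<kappa> \<Longrightarrow> x \<in> model_dom \<kappa>"
  by (auto simp: model_def model_dom_def)

text \<open>Replaces the span by one linear equation, the form in which horizontality of a velocity
  is checked and used.\<close>

lemma model_plane_iff:
  assumes "0 < frame_sq \<kappa> x"
  shows "v \<in> model_plane \<kappa> f x \<longleftrightarrow> v \<in> space3 \<and> frame_sq \<kappa> x * v $ 3 = f x * beta \<kappa> x v"
proof
  assume "v \<in> model_plane \<kappa> f x"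
  then obtain r s where "v = r *\<^sub>R frameR \<kappa> x + s *\<^sub>R frameY \<kappa> f x"
    unfolding model_plane_def span_breakdown_eq by (auto simp: algebra_simps)
  then have "v = vec3 (r * frame_re \<kappa> x - s * frame_im \<kappa> x) (r * frame_im \<kappa> x + s * frame_re \<kappa> x) (s * f x)"
    by (simp add: frameR_def frameY_def vec3_add vec3_scaleR)
  then show "v \<in> space3 \<and> frame_sq \<kappa> x * v $ 3 = f x * beta \<kappa> x v"
    by (simp add: frame_sq_def beta_def power2_eq_square algebra_simps)
next
  assume v: "v \<in> space3 \<and> frame_sq \<kappa> x * v $ 3 = f x * beta \<kappa> x v"
  \<comment> \<open>The coefficients along R and Y, read off with the normalised coframe.\<close>
  define r s where "r = alpha \<kappa> x v / frame_sq \<kappa> x" and "s = beta \<kappa> x v / frame_sq \<kappa> x"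
  have "v = r *\<^sub>R frameR \<kappa> x + s *\<^sub>R frameY \<kappa> f x"
  proof (rule space3_eqI)
    have "frame_sq \<kappa> x * v $ 1 = frame_sq \<kappa> x * (r * frame_re \<kappa> x - s * frame_im \<kappa> x)"
      using assms by (simp add: r_def s_def algebra_simps)
        (simp add: frame_sq_def alpha_def beta_def power2_eq_square algebra_simps)
    then show "v $ 1 = (r *\<^sub>R frameR \<kappa> x + s *\<^sub>R frameY \<kappa> f x) $ 1"
      using assms by (simp add: frameR_def frameY_def vec3_add vec3_scaleR)
    have "frame_sq \<kappa> x * v $ 2 = frame_sq \<kappa> x * (r * frame_im \<kappa> x + s * frame_re \<kappa> x)"
      using assms by (simp add: r_def s_def algebra_simps)
        (simp add: frame_sq_def alpha_def beta_def power2_eq_square algebra_simps)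
    then show "v $ 2 = (r *\<^sub>R frameR \<kappa> x + s *\<^sub>R frameY \<kappa> f x) $ 2"
      using assms by (simp add: frameR_def frameY_def vec3_add vec3_scaleR)
    show "v $ 3 = (r *\<^sub>R frameR \<kappa> x + s *\<^sub>R frameY \<kappa> f x) $ 3"
      using assms v by (simp add: frameR_def frameY_def vec3_add vec3_scaleR s_def field_simps)
  qed (use v in \<open>simp_all add: frameR_def frameY_def vec3_add vec3_scaleR\<close>)
  then show "v \<in> model_plane \<kappa> f x"
    unfolding model_plane_def by (metis insertI1 insertI2 span_add span_base span_scale)
qed

lemma alpha_model_time [simp]: "alpha \<kappa> x (model_time \<kappa> f x) = frame_sq \<kappa> x"
  and beta_model_time [simp]: "beta \<kappa> x (model_time \<kappa> f x) = frame_sq \<kappa> x"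
  by (simp_all add: model_time_def frameR_def frameY_def vec3_add alpha_def beta_def frame_sq_def
      power2_eq_square algebra_simps)

text \<open>The two conditions say that the product and the sum of \<open>alpha\<close> and
  \<open>beta\<close> are positive, up to positive factors; together they force both to be
  positive.\<close>

lemma timelike_future_iff:
  assumes "0 < frame_sq \<kappa> x"
  shows "model_metric \<kappa> x v v < 0 \<and> model_metric \<kappa> x (model_time \<kappa> f x) v < 0 \<longleftrightarrow> 0 < alpha \<kappa> x v \<and> 0 < beta \<kappa> x v"
proof -
  have "model_metric \<kappa> x v v < 0 \<longleftrightarrow> 0 < alpha \<kappa> x v * beta \<kappa> x v"
    by (simp add: model_metric_def)
  moreover have "model_metric \<kappa> x (model_time \<kappa> f x) v = - (frame_sq \<kappa> x * (alpha \<kappa> x v + beta \<kappa> x v))"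
    by (simp add: model_metric_def algebra_simps)
  ultimately show ?thesis using assms by (simp add: zero_less_mult_iff) linarith
qed

lemma linear_alpha: "linear (alpha \<kappa> x)" and linear_beta: "linear (beta \<kappa> x)"
  by (rule linearI; simp add: alpha_def beta_def algebra_simps)+

lemma lorentzian_model_metric:
  assumes c: "0 < frame_sq \<kappa> x"
  shows "lorentzian_form_on (model_metric \<kappa> x) (model_plane \<kappa> f x)"
proof -
  note lin = linear_add[OF linear_alpha] linear_add[OF linear_beta]
    linear_cmul[OF linear_alpha] linear_cmul[OF linear_beta]
  have model_time: "model_time \<kappa> f x \<in> model_plane \<kappa> f x"
    unfolding model_time_def model_plane_def by (intro span_add span_base) auto
  have zero: "v = 0" if v: "v \<in> model_plane \<kappa> f x" "alpha \<kappa> x v = 0" "beta \<kappa> x v = 0" for v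
  proof (rule space3_eqI)
    have "frame_sq \<kappa> x * v $ 1 = frame_re \<kappa> x * alpha \<kappa> x v - frame_im \<kappa> x * beta \<kappa> x v"
      "frame_sq \<kappa> x * v $ 2 = frame_im \<kappa> x * alpha \<kappa> x v + frame_re \<kappa> x * beta \<kappa> x v"
      by (simp_all add: frame_sq_def alpha_def beta_def power2_eq_square algebra_simps)
    then show "v $ 1 = 0 $ 1" "v $ 2 = 0 $ 2" using v c by simp_all
    show "v $ 3 = 0 $ 3" using v c model_plane_iff[OF c] by simp
  qed (use v model_plane_iff[OF c] subspace_0[OF subspace_space3] in auto)
  \<comment> \<open>Nondegeneracy: pairing with R isolates \<open>beta\<close>, pairing with Y
    isolates \<open>alpha\<close>.\<close>
  have "v = 0" if v: "v \<in> model_plane \<kappa> f x" and orth: "\<And>w. w \<in> model_plane \<kappa> f x \<Longrightarrow> model_metric \<kappa> x v w = 0" for v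
  proof -
    have RY: "frameR \<kappa> x \<in> model_plane \<kappa> f x" "frameY \<kappa> f x \<in> model_plane \<kappa> f x"
      unfolding model_plane_def by (auto intro: span_base)
    have "alpha \<kappa> x (frameR \<kappa> x) = frame_sq \<kappa> x" "beta \<kappa> x (frameR \<kappa> x) = 0"
      "alpha \<kappa> x (frameY \<kappa> f x) = 0" "beta \<kappa> x (frameY \<kappa> f x) = frame_sq \<kappa> x"
      by (simp_all add: alpha_def beta_def frameR_def frameY_def frame_sq_def power2_eq_square algebra_simps)
    then show "v = 0"
      using orth[OF RY(1)] orth[OF RY(2)] zero[OF v] c by (simp add: model_metric_def)
  qed
  moreover have "subspace (span {model_time \<kappa> f x})" "span {model_time \<kappa> f x} \<subseteq> model_plane \<kappa> f x"
    "dim (span {model_time \<kappa> f x}) = 1" "neg_definite_on (model_metric \<kappa> x) (span {model_time \<kappa> f x})"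
  proof -
    show "subspace (span {model_time \<kappa> f x})" by simp
    show "span {model_time \<kappa> f x} \<subseteq> model_plane \<kappa> f x"
      using model_time unfolding model_plane_def by (simp add: span_minimal)
    have "alpha \<kappa> x (model_time \<kappa> f x) \<noteq> alpha \<kappa> x 0" using c linear_0[OF linear_alpha] by simp
    then have "model_time \<kappa> f x \<noteq> 0" by metis
    then show "dim (span {model_time \<kappa> f x}) = 1"
      by (simp add: dim_insert)
    show "neg_definite_on (model_metric \<kappa> x) (span {model_time \<kappa> f x})"
      unfolding neg_definite_on_def
    proof (intro ballI impI)
      fix w assume "w \<in> span {model_time \<kappa> f x}" "w \<noteq> 0"
      then obtain r where "w = r *\<^sub>R model_time \<kappa> f x" "r \<noteq> 0" by (auto simp: span_singleton)
      then have "model_metric \<kappa> x w w = - 2 * (r * frame_sq \<kappa> x)\<^sup>2"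
        by (simp add: model_metric_def lin power2_eq_square)
      then show "model_metric \<kappa> x w w < 0" using c \<open>r \<noteq> 0\<close> by simp
    qed
  qed
  moreover have "dim W \<le> 1"
    if W: "subspace W" "W \<subseteq> model_plane \<kappa> f x" "neg_definite_on (model_metric \<kappa> x) W" for W
  proof -
    \<comment> \<open>The index is at most 1 because vectors with \<open>alpha\<close> equal to 0
      are null: on a negative definite subspace \<open>alpha\<close> is an injective map to the
      reals.\<close>
    have inj: "v = 0" if "v \<in> W" "alpha \<kappa> x v = 0" for v
    proof (rule ccontr)
      assume "v \<noteq> 0"
      with W(3) \<open>v \<in> W\<close> have "model_metric \<kappa> x v v < 0" unfolding neg_definite_on_def by blast
      then show False by (simp add: model_metric_def that(2))
    qed
    have "span W = W" using W(1) by (simp add: span_eq_iff)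
    then have "inj_on (alpha \<kappa> x) (span W)"
      unfolding linear_inj_on_iff_eq_0[OF linear_alpha subspace_span] using inj by blast
    then have "dim (alpha \<kappa> x ` W) = dim W" by (rule dim_image_eq[OF linear_alpha])
    then show ?thesis using dim_subset_UNIV[of "alpha \<kappa> x ` W"] by simp
  qed
  moreover have "model_metric \<kappa> x (r *\<^sub>R u + s *\<^sub>R v) w = r * model_metric \<kappa> x u w + s * model_metric \<kappa> x v w" for r s u v w
    by (simp add: model_metric_def lin algebra_simps)
  moreover have "model_metric \<kappa> x u v = model_metric \<kappa> x v u" for u v
    by (simp add: model_metric_def)
  ultimately show ?thesis
    unfolding lorentzian_form_on_def by (intro conjI ballI allI impI exI[of _ "span {model_time \<kappa> f x}"]) blast+
qed

section \<open>The underlying manifold and its tangent spaces\<close>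

lemma open_line_model_dom: "open {t. p + t *\<^sub>R v \<in> model_dom \<kappa>}"
proof -
  have "continuous_on UNIV (\<lambda>t. p + t *\<^sub>R v)" by (intro continuous_intros)
  from open_vimage[OF open_model_dom[of \<kappa>] this] show ?thesis by (simp add: vimage_def)
qed

lemma line_model: "p \<in> model \<kappa> \<Longrightarrow> v \<in> space3 \<Longrightarrow> p + t *\<^sub>R v \<in> model_dom \<kappa> \<Longrightarrow> p + t *\<^sub>R v \<in> model \<kappa>"
  using subspace_space3 by (simp add: model_def subspace_add subspace_scale)

lemma tangent_space_model:
  assumes p: "p \<in> model \<kappa>"
  shows "tangent_space (model \<kappa>) p = space3"
proof (intro set_eqI iffI)
  fix v assume "v \<in> tangent_space (model \<kappa>) p"
  then obtain \<gamma> where \<gamma>: "\<And>t. \<gamma> t \<in> model \<kappa>" "(\<gamma> has_vector_derivative v) (at 0)"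
    by (auto simp: tangent_space_def)
  have "v $ i = 0" if "i \<notin> {1, 2, 3}" for i
  proof -
    have "((\<lambda>t. \<gamma> t $ i) has_vector_derivative v $ i) (at 0)"
      by (rule bounded_linear.has_vector_derivative[OF bounded_linear_vec_nth \<gamma>(2)])
    moreover have "\<gamma> t $ i = 0" for t
      using model_space3[OF \<gamma>(1)[of t]] that by (simp add: space3_def)
    ultimately show ?thesis
      using vector_derivative_unique_at has_vector_derivative_const by (metis (no_types, lifting) ext)
  qed
  then show "v \<in> space3" by (simp add: space3_def)
next
  fix v assume v: "v \<in> space3"
  \<comment> \<open>A tangent vector must come from a curve that stays in the manifold for all real
    times. The straight line may leave it, so it is replaced by the constant p there; near time 0
    nothing changes.\<close>
  define \<gamma> where "\<gamma> t = (if p + t *\<^sub>R v \<in> model_dom \<kappa> then p + t *\<^sub>R v else p)" for t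
  have "((\<lambda>t. p + t *\<^sub>R v) has_vector_derivative v) (at 0)"
    by (auto intro!: derivative_eq_intros)
  then have "(\<gamma> has_vector_derivative v) (at 0)"
    by (rule has_vector_derivative_transform_within_open[OF _ open_line_model_dom[of p v \<kappa>]])
      (use model_in_model_dom[OF p] in \<open>auto simp: \<gamma>_def\<close>)
  moreover have "\<gamma> t \<in> model \<kappa>" for t using line_model p v by (simp add: \<gamma>_def)
  moreover have "\<gamma> 0 = p" by (simp add: \<gamma>_def)
  ultimately show "v \<in> tangent_space (model \<kappa>) p" unfolding tangent_space_def by blast
qed

lemma embedded_model: "embedded_submanifold 3 (model \<kappa>)"
  unfolding embedded_submanifold_def
proof
  fix p assume "p \<in> model \<kappa>"
  have "diffeo_between (model_dom \<kappa>) (model_dom \<kappa>) (\<lambda>x. x)"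
    unfolding diffeo_between_def
    by (intro exI[of _ "\<lambda>x. x"]) (simp add: smooth_on_bounded_linear open_model_dom)
  then show "\<exists>U V \<phi> L. p \<in> U \<and> diffeo_between U V \<phi> \<and>
        subspace L \<and> dim L = 3 \<and> \<phi> ` (model \<kappa> \<inter> U) = V \<inter> L"
    using subspace_space3 dim_space3 model_in_model_dom[OF \<open>p \<in> model \<kappa>\<close>]
    by (intro exI[of _ "model_dom \<kappa>"] exI[of _ "\<lambda>x. x"] exI[of _ space3]) (auto simp: model_def)
qed

section \<open>The horizontal distribution and its brackets\<close>

lemma frame_coframe:
  "alpha \<kappa> x (frameR \<kappa> x) = frame_sq \<kappa> x" "beta \<kappa> x (frameR \<kappa> x) = 0"
  "alpha \<kappa> x (frameY \<kappa> f x) = 0" "beta \<kappa> x (frameY \<kappa> f x) = frame_sq \<kappa> x"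
  by (simp_all add: alpha_def beta_def frameR_def frameY_def frame_sq_def power2_eq_square algebra_simps)

lemma dim_model_plane:
  assumes "0 < frame_sq \<kappa> x"
  shows "dim (model_plane \<kappa> f x) = 2"
proof -
  have R: "frameR \<kappa> x \<notin> span {frameY \<kappa> f x}"
  proof
    assume "frameR \<kappa> x \<in> span {frameY \<kappa> f x}"
    then obtain r where "frameR \<kappa> x = r *\<^sub>R frameY \<kappa> f x" by (auto simp: span_singleton)
    then have "alpha \<kappa> x (frameR \<kappa> x) = r *\<^sub>R alpha \<kappa> x (frameY \<kappa> f x)"
      using linear_cmul[OF linear_alpha] by metis
    with assms show False by (simp add: frame_coframe)
  qed
  have "frameY \<kappa> f x \<noteq> 0"
    using frame_coframe(4)[of \<kappa> x f] linear_0[OF linear_beta[of \<kappa> x]] assms by auto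
  with R show ?thesis unfolding model_plane_def by (simp add: dim_insert)
qed

lemma frame_in_model_plane: "frameR \<kappa> x \<in> model_plane \<kappa> f x" "frameY \<kappa> f x \<in> model_plane \<kappa> f x"
  unfolding model_plane_def by (auto intro: span_base)

lemma smooth_distribution_model_plane:
  assumes "smooth_on (model_dom \<kappa>) f"
  shows "smooth_distribution (model \<kappa>) 2 (model_plane \<kappa> f)"
  unfolding smooth_distribution_def
proof (intro conjI ballI)
  fix p assume p: "p \<in> model \<kappa>"
  show "subspace (model_plane \<kappa> f p)" by (simp add: model_plane_def)
  show "dim (model_plane \<kappa> f p) = 2" using dim_model_plane model_frame_sq[OF p] by blast
  show "model_plane \<kappa> f p \<subseteq> tangent_space (model \<kappa>) p"
    using model_plane_iff[OF model_frame_sq[OF p]] tangent_space_model[OF p] by blast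
  define X where "X i = (if i = 0 then frameR \<kappa> else frameY \<kappa> f)" for i :: nat
  have "{..<2::nat} = {0, 1}" by auto
  then have "model_plane \<kappa> f q = span ((\<lambda>i. X i q) ` {..<2})" for q
    by (simp add: X_def model_plane_def)
  moreover have "smooth_on (model_dom \<kappa>) (X i)" for i
    using assms by (simp add: X_def smooth_on_frameR smooth_on_frameY open_model_dom)
  ultimately show "\<exists>U X. p \<in> U \<and> (\<forall>i<2::nat. smooth_on U (X i)) \<and>
        (\<forall>q\<in>model \<kappa> \<inter> U. model_plane \<kappa> f q = span ((\<lambda>i. X i q) ` {..<2}))"
    using model_in_model_dom[OF p] by (intro exI[of _ "model_dom \<kappa>"] exI[of _ X]) auto
qed

text \<open>Off the manifold \<open>Z\<close> may leave \<open>space3\<close>, so only derivatives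
  in directions tangent to \<open>space3\<close> are controlled. Along the line through p in such a
  direction the remaining coordinates of \<open>Z\<close> vanish near p.\<close>

lemma directional_derivative_in_space3:
  assumes Z: "smooth_on (model_dom \<kappa>) Z" "\<And>q. q \<in> model \<kappa> \<Longrightarrow> Z q \<in> space3"
    and p: "p \<in> model \<kappa>" and w: "w \<in> space3"
  shows "frechet_derivative Z (at p) w \<in> space3"
proof -
  have "((\<lambda>t. p + t *\<^sub>R w) has_derivative (\<lambda>t. t *\<^sub>R w)) (at 0)"
    by (auto intro!: derivative_eq_intros)
  moreover have "(Z has_derivative frechet_derivative Z (at p)) (at (p + 0 *\<^sub>R w))"
    using smooth_on_has_derivative[OF Z(1) model_in_model_dom[OF p]] by simp
  ultimately have d: "((\<lambda>t. Z (p + t *\<^sub>R w)) has_derivative (\<lambda>t. frechet_derivative Z (at p) (t *\<^sub>R w))) (at 0)"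
    by (rule has_derivative_compose)
  have "frechet_derivative Z (at p) w $ i = 0" if "i \<notin> {1, 2, 3}" for i
  proof -
    have di: "((\<lambda>t. Z (p + t *\<^sub>R w) $ i) has_derivative (\<lambda>t. frechet_derivative Z (at p) (t *\<^sub>R w) $ i)) (at 0)"
      by (rule bounded_linear.has_derivative[OF bounded_linear_vec_nth d])
    have Z0: "Z (p + t *\<^sub>R w) $ i = 0" if "t \<in> {t. p + t *\<^sub>R w \<in> model_dom \<kappa>}" for t
      using Z(2)[OF line_model[OF p w]] that \<open>i \<notin> {1, 2, 3}\<close> by (simp add: space3_def)
    have "((\<lambda>t::real. 0) has_derivative (\<lambda>t. frechet_derivative Z (at p) (t *\<^sub>R w) $ i)) (at 0)"
      by (rule has_derivative_transform_within_open[OF di open_line_model_dom[of p w \<kappa>]])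
        (use model_in_model_dom[OF p] Z0 in auto)
    then have "(\<lambda>t. frechet_derivative Z (at p) (t *\<^sub>R w) $ i) = (\<lambda>t. 0)"
      using has_derivative_unique has_derivative_const by blast
    from fun_cong[OF this, of 1] show ?thesis by simp
  qed
  then show ?thesis by (simp add: space3_def)
qed

text \<open>Brackets of fields tangent to the manifold stay tangent. This bounds the span of all
  brackets by the tangent space; smoothness is carried along to keep the induction going.\<close>

lemma iterated_brackets_model:
  assumes "Z \<in> iterated_brackets (model \<kappa>) (model_plane \<kappa> f) (model_dom \<kappa>)"
  shows "smooth_on (model_dom \<kappa>) Z \<and> (\<forall>q\<in>model \<kappa>. Z q \<in> space3)"
  using assms
proof induction
  case (base X)
  then show ?case
    using model_plane_iff model_frame_sq model_in_model_dom unfolding horizontal_field_def by blast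
next
  case (bracket X Y)
  then have "smooth_on (model_dom \<kappa>) (lie_bracket X Y)" by (blast intro: smooth_on_lie_bracket)
  moreover have "lie_bracket X Y q \<in> space3" if "q \<in> model \<kappa>" for q
    unfolding lie_bracket_def using bracket.IH that
    by (intro subspace_diff[OF subspace_space3] directional_derivative_in_space3) auto
  ultimately show ?case by blast
qed

lemma has_derivative_frame_re: "(frame_re \<kappa> has_derivative (\<lambda>v. \<kappa> * (v $ 1 - v $ 2))) (at x)"
  unfolding frame_re_def
  by (rule derivative_eq_intros bounded_linear_imp_has_derivative[OF bounded_linear_vec_nth]
      | simp add: algebra_simps)+

lemma has_derivative_frame_im: "(frame_im \<kappa> has_derivative (\<lambda>v. \<kappa> * (v $ 1 + v $ 2))) (at x)"
  unfolding frame_im_def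
  by (rule derivative_eq_intros bounded_linear_imp_has_derivative[OF bounded_linear_vec_nth]
      | simp add: algebra_simps)+

lemma has_derivative_frameR:
  "(frameR \<kappa> has_derivative (\<lambda>v. vec3 (\<kappa> * (v $ 1 - v $ 2)) (\<kappa> * (v $ 1 + v $ 2)) 0)) (at x)"
  unfolding frameR_def
  by (intro has_derivative_vec3 has_derivative_frame_re has_derivative_frame_im has_derivative_const)

lemma has_derivative_frameY:
  assumes "(f has_derivative f') (at x)"
  shows "(frameY \<kappa> f has_derivative
    (\<lambda>v. vec3 (- (\<kappa> * (v $ 1 + v $ 2))) (\<kappa> * (v $ 1 - v $ 2)) (f' v))) (at x)"
  unfolding frameY_def
  by (intro has_derivative_vec3 has_derivative_frame_re has_derivative_frame_im has_derivative_minus assms)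

text \<open>The planar parts commute because both are complex multiples of the same field 1 or w, so
  only the derivative of the height component of Y remains.\<close>

lemma lie_bracket_frame:
  assumes "(f has_derivative f') (at x)"
  shows "lie_bracket (frameR \<kappa>) (frameY \<kappa> f) x = vec3 0 0 (f' (frameR \<kappa> x))"
  unfolding lie_bracket_def frechet_derivative_at[OF has_derivative_frameR, symmetric]
    frechet_derivative_at[OF has_derivative_frameY[OF assms], symmetric]
  by (simp add: frameY_def vec3_diff) (simp add: frameR_def algebra_simps)

lemma lie_bracket_vertical:
  assumes "(\<phi> has_derivative \<phi>') (at x)"
  shows "lie_bracket (frameR \<kappa>) (\<lambda>x. vec3 0 0 (\<phi> x)) x = vec3 0 0 (\<phi>' (frameR \<kappa> x))"
proof -
  have "((\<lambda>x. vec3 0 0 (\<phi> x)) has_derivative (\<lambda>v. vec3 0 0 (\<phi>' v))) (at x)"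
    by (intro has_derivative_vec3 assms has_derivative_const)
  then show ?thesis
    unfolding lie_bracket_def frechet_derivative_at[OF has_derivative_frameR, symmetric]
    by (simp add: frechet_derivative_at[symmetric] vec3_diff)
qed

lemma bracket_generating_model_plane:
  assumes f: "smooth_on (model_dom \<kappa>) f"
    and vert: "\<And>p. p \<in> model \<kappa> \<Longrightarrow>
      \<exists>Z r. Z \<in> iterated_brackets (model \<kappa>) (model_plane \<kappa> f) (model_dom \<kappa>) \<and> Z p = vec3 0 0 r \<and> r \<noteq> 0"
  shows "bracket_generating (model \<kappa>) (model_plane \<kappa> f)"
  unfolding bracket_generating_def
proof
  fix p assume p: "p \<in> model \<kappa>"
  let ?I = "iterated_brackets (model \<kappa>) (model_plane \<kappa> f) (model_dom \<kappa>)"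
  let ?S = "span ((\<lambda>Z. Z p) ` ?I)"
  have "?S \<subseteq> space3"
    using iterated_brackets_model[of _ \<kappa> f] p by (intro span_minimal subspace_space3) blast
  moreover have "space3 \<subseteq> ?S"
  proof
    fix v assume v: "v \<in> space3"
    have "frameR \<kappa> \<in> ?I" "frameY \<kappa> f \<in> ?I"
      using f by (auto intro!: iterated_brackets.base
          simp: horizontal_field_def smooth_on_frameR smooth_on_frameY open_model_dom frame_in_model_plane)
    then have "model_plane \<kappa> f p \<subseteq> ?S"
      unfolding model_plane_def by (intro span_mono) auto
    \<comment> \<open>The amount by which the third coordinate of v misses horizontality; removing
      it leaves a horizontal vector.\<close>
    define e where "e = v $ 3 - f p * beta \<kappa> p v / frame_sq \<kappa> p"
    have "v - vec3 0 0 e \<in> model_plane \<kappa> f p"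
      unfolding model_plane_iff[OF model_frame_sq[OF p]]
      using v model_frame_sq[OF p] subspace_diff[OF subspace_space3]
      by (simp add: e_def beta_def field_simps)
    then have 1: "v - vec3 0 0 e \<in> ?S" using \<open>model_plane \<kappa> f p \<subseteq> ?S\<close> by blast
    obtain Z r where Z: "Z \<in> ?I" "Z p = vec3 0 0 r" "r \<noteq> 0" using vert[OF p] by blast
    then have "(e / r) *\<^sub>R vec3 0 0 r \<in> ?S" by (metis image_eqI span_base span_scale)
    then have "vec3 0 0 e \<in> ?S" using \<open>r \<noteq> 0\<close> by (simp add: vec3_scaleR)
    from span_add[OF 1 this] show "v \<in> ?S" by simp
  qed
  ultimately show "\<exists>U. open U \<and> p \<in> U \<and>
      span ((\<lambda>Z. Z p) ` iterated_brackets (model \<kappa>) (model_plane \<kappa> f) U) = tangent_space (model \<kappa>) p"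
    using open_model_dom model_in_model_dom[OF p] tangent_space_model[OF p] by blast
qed

lemma smooth_on_model_metric:
  assumes "smooth_on U X" "smooth_on U Y"
  shows "smooth_on U (\<lambda>q. model_metric \<kappa> q (X q) (Y q))"
  using smooth_on_open[OF assms(1)] unfolding model_metric_def alpha_def beta_def
  by (intro smooth_on_minus smooth_on_add smooth_on_mult smooth_on_frame_re smooth_on_frame_im smooth_on_nth assms)

lemma sub_spacetime_frame:
  assumes s: "smooth_on (model_dom \<kappa>) s"
    and Rs: "\<And>x. x \<in> model_dom \<kappa> \<Longrightarrow> frechet_derivative s (at x) (frameR \<kappa> x) = 1"
    and f: "f = s \<or> f = (\<lambda>x. (s x)\<^sup>2)"
    and M: "model \<kappa> \<noteq> {}" "connected (model \<kappa>)"
  shows "sub_spacetime (model \<kappa>) (model_plane \<kappa> f) (model_metric \<kappa>) (model_time \<kappa> f)"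
proof -
  let ?I = "iterated_brackets (model \<kappa>) (model_plane \<kappa> f) (model_dom \<kappa>)"
  have sf: "smooth_on (model_dom \<kappa>) f" using f s smooth_on_power2 by blast
  have RY: "frameR \<kappa> \<in> ?I" "frameY \<kappa> f \<in> ?I"
    using sf by (auto intro!: iterated_brackets.base
        simp: horizontal_field_def smooth_on_frameR smooth_on_frameY open_model_dom frame_in_model_plane)
  have ds: "(s has_derivative frechet_derivative s (at x)) (at x)" if "x \<in> model_dom \<kappa>" for x
    using smooth_on_has_derivative[OF s that] .
  have ds2: "((\<lambda>x. (s x)\<^sup>2) has_derivative (\<lambda>v. 2 * s x * frechet_derivative s (at x) v)) (at x)"
    if "x \<in> model_dom \<kappa>" for x
    by (rule derivative_eq_intros ds[OF that] refl | simp add: mult_ac)+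
  have "\<exists>Z r. Z \<in> ?I \<and> Z p = vec3 0 0 r \<and> r \<noteq> 0" if "p \<in> model \<kappa>" for p
  proof -
    have p: "p \<in> model_dom \<kappa>" using model_in_model_dom[OF that] .
    from f show ?thesis
    proof
      assume "f = s"
      then have "lie_bracket (frameR \<kappa>) (frameY \<kappa> f) p = vec3 0 0 1"
        using lie_bracket_frame[OF ds[OF p]] Rs[OF p] by simp
      then show ?thesis using RY iterated_brackets.bracket zero_neq_one by metis
    next
      assume fs: "f = (\<lambda>x. (s x)\<^sup>2)"
      \<comment> \<open>This bracket degenerates where s = 0. A further bracket with R
        differentiates its coefficient 2 s to the constant 2.\<close>
      define B where "B = lie_bracket (frameR \<kappa>) (frameY \<kappa> f)"
      have B: "B x = vec3 0 0 (2 * s x)" if "x \<in> model_dom \<kappa>" for x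
        unfolding B_def fs using lie_bracket_frame[OF ds2[OF that]] Rs[OF that] by simp
      have d2: "((\<lambda>x. 2 * s x) has_derivative (\<lambda>v. 2 * frechet_derivative s (at p) v)) (at p)"
        by (rule derivative_eq_intros ds[OF p] refl | simp)+
      have "((\<lambda>x. vec3 0 0 (2 * s x)) has_derivative
          (\<lambda>v. vec3 0 0 (2 * frechet_derivative s (at p) v))) (at p)"
        by (intro has_derivative_vec3 d2 has_derivative_const)
      \<comment> \<open>The formula for \<open>B\<close> is known only on \<open>model_dom\<close>,
        but derivatives at p depend only on values near p.\<close>
      then have "frechet_derivative B (at p) = frechet_derivative (\<lambda>x. vec3 0 0 (2 * s x)) (at p)"
        using frechet_derivative_transform_within_open[OF _ open_model_dom p, of "\<lambda>x. vec3 0 0 (2 * s x)" B] B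
          differentiableI by metis
      then have "lie_bracket (frameR \<kappa>) B p = lie_bracket (frameR \<kappa>) (\<lambda>x. vec3 0 0 (2 * s x)) p"
        using B[OF p] by (simp add: lie_bracket_def)
      also have "\<dots> = vec3 0 0 2"
        using lie_bracket_vertical[OF d2] Rs[OF p] by simp
      finally have "lie_bracket (frameR \<kappa>) B p = vec3 0 0 2" .
      moreover have "lie_bracket (frameR \<kappa>) B \<in> ?I"
        unfolding B_def by (intro iterated_brackets.bracket RY)
      ultimately show ?thesis by (intro exI[of _ "lie_bracket (frameR \<kappa>) B"] exI[of _ 2]) simp
    qed
  qed
  then have "bracket_generating (model \<kappa>) (model_plane \<kappa> f)"
    by (rule bracket_generating_model_plane[OF sf])
  moreover have "sub_lorentzian_metric (model \<kappa>) (model_plane \<kappa> f) (model_metric \<kappa>)"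
    unfolding sub_lorentzian_metric_def
  proof (intro conjI ballI allI impI)
    fix p assume "p \<in> model \<kappa>"
    then show "lorentzian_form_on (model_metric \<kappa> p) (model_plane \<kappa> f p)" by (intro lorentzian_model_metric model_frame_sq)
  next
    fix U X Y
    assume "horizontal_field (model \<kappa>) (model_plane \<kappa> f) U X \<and> horizontal_field (model \<kappa>) (model_plane \<kappa> f) U Y"
    then have "smooth_on U (\<lambda>q. model_metric \<kappa> q (X q) (Y q))"
      unfolding horizontal_field_def by (intro smooth_on_model_metric) simp_all
    then show "smooth_on_set (model \<kappa> \<inter> U) (\<lambda>q. model_metric \<kappa> q (X q) (Y q))"
      unfolding smooth_on_set_def by blast
  qed
  moreover have "smooth_on_set (model \<kappa>) (model_time \<kappa> f)"
  proof -
    have "smooth_on (model_dom \<kappa>) (model_time \<kappa> f)"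
      unfolding model_time_def by (intro smooth_on_add smooth_on_frameR smooth_on_frameY sf open_model_dom)
    then show ?thesis unfolding smooth_on_set_def using model_in_model_dom by blast
  qed
  moreover have "model_time \<kappa> f p \<in> model_plane \<kappa> f p \<and> model_metric \<kappa> p (model_time \<kappa> f p) (model_time \<kappa> f p) < 0"
    if "p \<in> model \<kappa>" for p
  proof
    show "model_time \<kappa> f p \<in> model_plane \<kappa> f p"
      unfolding model_time_def model_plane_def by (intro span_add span_base) simp_all
    show "model_metric \<kappa> p (model_time \<kappa> f p) (model_time \<kappa> f p) < 0"
      using model_frame_sq[OF that] by (simp add: model_metric_def)
  qed
  moreover have "\<exists>n k. embedded_submanifold n (model \<kappa>) \<and> 2 \<le> k \<and> k < n \<and>
      smooth_distribution (model \<kappa>) k (model_plane \<kappa> f)"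
    by (rule exI[of _ 3], rule exI[of _ 2])
      (simp add: embedded_model smooth_distribution_model_plane[OF sf])
  ultimately show ?thesis
    unfolding sub_spacetime_def using M by (intro conjI ballI) simp_all
qed

section \<open>Timelike curves in the models\<close>

abbreviation chron_model where
  "chron_model \<kappa> f \<equiv> chron (model \<kappa>) (model_plane \<kappa> f) (model_metric \<kappa>) (model_time \<kappa> f)"

lemma norm_vec3: "norm (vec3 x y z) \<le> \<bar>x\<bar> + \<bar>y\<bar> + \<bar>z\<bar>"
proof -
  have "norm (vec3 x y z) \<le> norm (x *\<^sub>R axis 1 1 + y *\<^sub>R axis 2 1 :: ambient) + norm (z *\<^sub>R axis 3 1 :: ambient)"
    unfolding vec3_def by (rule norm_triangle_ineq)
  also have "\<dots> \<le> (norm (x *\<^sub>R axis 1 1 :: ambient) + norm (y *\<^sub>R axis 2 1 :: ambient)) + norm (z *\<^sub>R axis 3 1 :: ambient)"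
    by (intro add_right_mono norm_triangle_ineq)
  finally show ?thesis by (simp add: norm_axis_1)
qed

lemma has_vector_derivative_vec3:
  assumes "(x has_real_derivative x') F" "(y has_real_derivative y') F" "(z has_real_derivative z') F"
  shows "((\<lambda>t. vec3 (x t) (y t) (z t)) has_vector_derivative vec3 x' y' z') F"
proof -
  have "((\<lambda>t. vec3 (x t) (y t) (z t)) has_derivative (\<lambda>v. vec3 (x' * v) (y' * v) (z' * v))) F"
    using assms unfolding has_field_derivative_def by (rule has_derivative_vec3)
  then show ?thesis
    unfolding has_vector_derivative_def by (simp add: vec3_scaleR mult.commute)
qed

text \<open>Explicit curves with continuous velocity: all conditions hold at every time, and the
  integral representation is the fundamental theorem of calculus.\<close>

lemma htfd_curve_vec3:
  assumes "a < b"
    and d: "\<And>t. (x has_real_derivative x' t) (at t)" "\<And>t. (y has_real_derivative y' t) (at t)"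
      "\<And>t. (z has_real_derivative z' t) (at t)"
    and c: "continuous_on {a..b} x'" "continuous_on {a..b} y'" "continuous_on {a..b} z'"
    and frame_sq: "\<And>t. t \<in> {a..b} \<Longrightarrow> 0 < frame_sq \<kappa> (vec3 (x t) (y t) (z t))"
    and al: "\<And>t. t \<in> {a..b} \<Longrightarrow> 0 < alpha \<kappa> (vec3 (x t) (y t) (z t)) (vec3 (x' t) (y' t) (z' t))"
    and be: "\<And>t. t \<in> {a..b} \<Longrightarrow> 0 < beta \<kappa> (vec3 (x t) (y t) (z t)) (vec3 (x' t) (y' t) (z' t))"
    and hor: "\<And>t. t \<in> {a..b} \<Longrightarrow> frame_sq \<kappa> (vec3 (x t) (y t) (z t)) * z' t =
      f (vec3 (x t) (y t) (z t)) * beta \<kappa> (vec3 (x t) (y t) (z t)) (vec3 (x' t) (y' t) (z' t))"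
  shows "htfd_curve (model \<kappa>) (model_plane \<kappa> f) (model_metric \<kappa>) (model_time \<kappa> f) a b (\<lambda>t. vec3 (x t) (y t) (z t))"
    (is "htfd_curve _ _ _ _ _ _ ?\<gamma>")
proof -
  define v where "v t = vec3 (x' t) (y' t) (z' t)" for t
  have dv: "(?\<gamma> has_vector_derivative v t) (at t)" for t
    unfolding v_def by (rule has_vector_derivative_vec3[OF d])
  have cv: "continuous_on {a..b} v"
    unfolding v_def vec3_def by (intro continuous_intros c)
  have "?\<gamma> ` {a..b} \<subseteq> model \<kappa>" using frame_sq by (auto simp: model_def model_dom_def)
  moreover have "v absolutely_integrable_on {a..b}"
    using cv by (rule absolutely_integrable_continuous_real)
  moreover have "(\<lambda>t. (norm (v t))\<^sup>2) integrable_on {a..b}"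
    by (intro integrable_continuous_real continuous_intros cv)
  moreover have "?\<gamma> t = ?\<gamma> a + integral {a..t} v" if "t \<in> {a..b}" for t
  proof -
    have "(v has_integral ?\<gamma> t - ?\<gamma> a) {a..t}"
      using that by (intro fundamental_theorem_of_calculus has_vector_derivative_at_within[OF dv]) simp
    then show ?thesis by (simp add: integral_unique)
  qed
  moreover have pw: "v t \<in> model_plane \<kappa> f (?\<gamma> t) \<and> model_metric \<kappa> (?\<gamma> t) (v t) (v t) < 0 \<and>
      model_metric \<kappa> (?\<gamma> t) (model_time \<kappa> f (?\<gamma> t)) (v t) < 0" if "t \<in> {a..b}" for t
    unfolding timelike_future_iff[OF frame_sq[OF that]] model_plane_iff[OF frame_sq[OF that]] v_def vec3_nth
    using al[OF that] be[OF that] hor[OF that] by (intro conjI vec3_in)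
  moreover have "AE t in lborel. t \<in> {a..b} \<longrightarrow> v t \<in> model_plane \<kappa> f (?\<gamma> t) \<and>
      model_metric \<kappa> (?\<gamma> t) (v t) (v t) < 0 \<and> model_metric \<kappa> (?\<gamma> t) (model_time \<kappa> f (?\<gamma> t)) (v t) < 0"
    by (rule AE_I2) (use pw in blast)
  ultimately show ?thesis
    unfolding htfd_curve_def using \<open>a < b\<close> by blast
qed

text \<open>What remains usable for an arbitrary timelike curve: coordinate increments are integrals
  of the velocity, which satisfies the causal inequalities and the horizontality equation almost
  everywhere.\<close>

lemma htfd_curve_coords:
  assumes "htfd_curve (model \<kappa>) (model_plane \<kappa> f) (model_metric \<kappa>) (model_time \<kappa> f) a b \<gamma>"
  shows "\<exists>v. a < b \<and> (\<forall>t\<in>{a..b}. \<gamma> t \<in> model \<kappa>) \<and>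
    (\<forall>s t i. a \<le> s \<longrightarrow> s \<le> t \<longrightarrow> t \<le> b \<longrightarrow> (\<lambda>r. v r $ i) integrable_on {s..t} \<and>
      \<gamma> t $ i - \<gamma> s $ i = integral {s..t} (\<lambda>r. v r $ i)) \<and>
    (AE t in lborel. t \<in> {a..b} \<longrightarrow> 0 < alpha \<kappa> (\<gamma> t) (v t) \<and> 0 < beta \<kappa> (\<gamma> t) (v t) \<and>
      frame_sq \<kappa> (\<gamma> t) * v t $ 3 = f (\<gamma> t) * beta \<kappa> (\<gamma> t) (v t))"
proof -
  from assms obtain v where ab: "a < b" "\<gamma> ` {a..b} \<subseteq> model \<kappa>"
    and v: "v absolutely_integrable_on {a..b}"
      "\<And>t. t\<in>{a..b} \<Longrightarrow> \<gamma> t = \<gamma> a + integral {a..t} v"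
      "AE t in lborel. t \<in> {a..b} \<longrightarrow> v t \<in> model_plane \<kappa> f (\<gamma> t) \<and>
         model_metric \<kappa> (\<gamma> t) (v t) (v t) < 0 \<and> model_metric \<kappa> (\<gamma> t) (model_time \<kappa> f (\<gamma> t)) (v t) < 0"
    unfolding htfd_curve_def by blast
  have \<gamma>: "\<gamma> t \<in> model \<kappa>" if "t \<in> {a..b}" for t using ab(2) that by auto
  have vi: "v integrable_on {s..t}" if "a \<le> s" "s \<le> t" "t \<le> b" for s t
    using v(1) that by (auto simp: absolutely_integrable_on_def intro: integrable_subinterval_real)
  have "\<gamma> t $ i - \<gamma> s $ i = integral {s..t} (\<lambda>r. v r $ i)" if st: "a \<le> s" "s \<le> t" "t \<le> b" for s t i
  proof -
    have "integral {a..s} v + integral {s..t} v = integral {a..t} v"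
      using st vi[of a t] by (intro Henstock_Kurzweil_Integration.integral_combine) auto
    then have "\<gamma> t - \<gamma> s = integral {s..t} v"
      using v(2)[of t] v(2)[of s] st by (simp add: algebra_simps)
    moreover have "integral {s..t} v $ i = integral {s..t} (\<lambda>r. v r $ i)"
      using integral_linear[OF vi[OF st] bounded_linear_vec_nth[of i]] by (simp add: o_def)
    ultimately show ?thesis by (metis vector_minus_component)
  qed
  moreover have "(\<lambda>r. v r $ i) integrable_on {s..t}" if "a \<le> s" "s \<le> t" "t \<le> b" for s t i
    using integrable_linear[OF vi[OF that] bounded_linear_vec_nth[of i]] by (simp add: o_def)
  moreover have "AE t in lborel. t \<in> {a..b} \<longrightarrow> 0 < alpha \<kappa> (\<gamma> t) (v t) \<and> 0 < beta \<kappa> (\<gamma> t) (v t) \<and>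
      frame_sq \<kappa> (\<gamma> t) * v t $ 3 = f (\<gamma> t) * beta \<kappa> (\<gamma> t) (v t)"
    using v(3)
  proof eventually_elim
    case (elim t)
    then show ?case
      using timelike_future_iff[OF model_frame_sq[OF \<gamma>]] model_plane_iff[OF model_frame_sq[OF \<gamma>]] by blast
  qed
  ultimately show ?thesis using ab(1) \<gamma> by (intro exI[of _ v]) simp
qed

lemma chron_model_height_mono:
  assumes "\<And>x. x \<in> model \<kappa> \<Longrightarrow> 0 \<le> f x" "chron_model \<kappa> f p q"
  shows "p $ 3 \<le> q $ 3"
proof -
  obtain a b \<gamma> where h: "htfd_curve (model \<kappa>) (model_plane \<kappa> f) (model_metric \<kappa>) (model_time \<kappa> f) a b \<gamma>" "\<gamma> a = p" "\<gamma> b = q"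
    using assms(2) unfolding chron_def by blast
  from htfd_curve_coords[OF h(1)] obtain v where v: "a < b" "\<forall>t\<in>{a..b}. \<gamma> t \<in> model \<kappa>"
    "\<forall>s t i. a \<le> s \<longrightarrow> s \<le> t \<longrightarrow> t \<le> b \<longrightarrow> (\<lambda>r. v r $ i) integrable_on {s..t} \<and>
      \<gamma> t $ i - \<gamma> s $ i = integral {s..t} (\<lambda>r. v r $ i)"
    "AE t in lborel. t \<in> {a..b} \<longrightarrow> 0 < alpha \<kappa> (\<gamma> t) (v t) \<and> 0 < beta \<kappa> (\<gamma> t) (v t) \<and>
      frame_sq \<kappa> (\<gamma> t) * v t $ 3 = f (\<gamma> t) * beta \<kappa> (\<gamma> t) (v t)"
    by blast
  have "0 \<le> integral {a..b} (\<lambda>r. v r $ 3)"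
  proof (rule integral_nonneg_AE_lborel, use v(4) in eventually_elim, intro impI)
    fix t assume *: "t \<in> {a..b} \<longrightarrow> 0 < alpha \<kappa> (\<gamma> t) (v t) \<and> 0 < beta \<kappa> (\<gamma> t) (v t) \<and>
      frame_sq \<kappa> (\<gamma> t) * v t $ 3 = f (\<gamma> t) * beta \<kappa> (\<gamma> t) (v t)" and t: "t \<in> {a..b}"
    then have "0 \<le> frame_sq \<kappa> (\<gamma> t) * v t $ 3"
      using assms(1)[OF bspec[OF v(2) t]] by (simp add: less_imp_le)
    then show "0 \<le> v t $ 3" using model_frame_sq[OF bspec[OF v(2) t]] by (simp add: zero_le_mult_iff)
  qed
  then show ?thesis using v(1) v(3)[rule_format, of a b 3] h(2,3) by simp
qed

text \<open>The vertical direction is tangent to the manifold, so points slightly below q lie in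
  every neighbourhood of q.\<close>

lemma not_open_above_height:
  assumes "q \<in> model \<kappa>" "q \<in> S" "\<And>x. x \<in> S \<Longrightarrow> q $ 3 \<le> x $ 3"
  shows "\<not> openin (top_of_set (model \<kappa>)) S"
proof
  assume "openin (top_of_set (model \<kappa>)) S"
  then obtain W where W: "open W" "S = model \<kappa> \<inter> W" by (auto simp: openin_open)
  have "open (model_dom \<kappa> \<inter> W)" by (intro open_Int open_model_dom W)
  moreover have "q \<in> model_dom \<kappa> \<inter> W" using assms W model_in_model_dom by blast
  ultimately obtain e where e: "e > 0" "ball q e \<subseteq> model_dom \<kappa> \<inter> W" by (meson open_contains_ball)
  define x where "x = q - vec3 0 0 (e / 2)"
  have "norm (vec3 0 0 (e / 2)) < e" using norm_vec3[of 0 0 "e / 2"] e(1) by simp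
  then have "x \<in> model_dom \<kappa> \<inter> W" using e(2) by (auto simp: x_def dist_norm subset_iff)
  then have "x \<in> S"
    using W(2) model_space3[OF assms(1)] subspace_diff[OF subspace_space3]
    by (simp add: x_def model_def)
  then show False using assms(3)[of x] e(1) by (simp add: x_def)
qed

section \<open>Constraints on timelike curves in the plane\<close>

lemma frame_plane [simp]: "frame_re 0 x = 1" "frame_im 0 x = 0" "frame_sq 0 x = 1" "alpha 0 x v = v $ 1" "beta 0 x v = v $ 2"
  by (simp_all add: frame_re_def frame_im_def frame_sq_def alpha_def beta_def)

lemma model_0: "model 0 = space3"
  by (simp add: model_def model_dom_def)

text \<open>Both planar coordinates increase strictly, which confines the curve to the open
  rectangle spanned by its endpoints. As z' = f y', a bound on f over this rectangle compares the
  gain in height with the gain in y.\<close>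

lemma chron_model_0_less:
  assumes "chron_model 0 f p q"
  shows "p $ 1 < q $ 1" "p $ 2 < q $ 2"
    "(\<And>x. p $ 1 < x $ 1 \<Longrightarrow> x $ 1 < q $ 1 \<Longrightarrow> p $ 2 < x $ 2 \<Longrightarrow> x $ 2 < q $ 2 \<Longrightarrow> f x < k)
      \<Longrightarrow> q $ 3 - p $ 3 < k * (q $ 2 - p $ 2)"
    "(\<And>x. p $ 1 < x $ 1 \<Longrightarrow> x $ 1 < q $ 1 \<Longrightarrow> p $ 2 < x $ 2 \<Longrightarrow> x $ 2 < q $ 2 \<Longrightarrow> k < f x)
      \<Longrightarrow> k * (q $ 2 - p $ 2) < q $ 3 - p $ 3"
proof -
  obtain a b \<gamma> where h: "htfd_curve (model 0) (model_plane 0 f) (model_metric 0) (model_time 0 f) a b \<gamma>" "\<gamma> a = p" "\<gamma> b = q"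
    using assms unfolding chron_def by blast
  from htfd_curve_coords[OF h(1)] obtain v where ab: "a < b" "\<forall>t\<in>{a..b}. \<gamma> t \<in> model 0"
    and v: "\<forall>s t i. a \<le> s \<longrightarrow> s \<le> t \<longrightarrow> t \<le> b \<longrightarrow> (\<lambda>r. v r $ i) integrable_on {s..t} \<and>
      \<gamma> t $ i - \<gamma> s $ i = integral {s..t} (\<lambda>r. v r $ i)"
    and ae0: "AE t in lborel. t \<in> {a..b} \<longrightarrow> 0 < alpha 0 (\<gamma> t) (v t) \<and> 0 < beta 0 (\<gamma> t) (v t) \<and>
      frame_sq 0 (\<gamma> t) * v t $ 3 = f (\<gamma> t) * beta 0 (\<gamma> t) (v t)"
    by blast
  have vi: "(\<lambda>r. v r $ i) integrable_on {s..t}"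
    and inc: "\<gamma> t $ i - \<gamma> s $ i = integral {s..t} (\<lambda>r. v r $ i)"
    if "a \<le> s" "s \<le> t" "t \<le> b" for s t i
    using v that by blast+
  have ae: "AE t in lborel. t \<in> {a..b} \<longrightarrow> 0 < v t $ 1 \<and> 0 < v t $ 2 \<and> v t $ 3 = f (\<gamma> t) * v t $ 2"
    using ae0 by simp
  have mono: "\<gamma> s $ i < \<gamma> t $ i" if "i = 1 \<or> i = 2" "a \<le> s" "s < t" "t \<le> b" for s t i
  proof -
    have "AE r in lborel. r \<in> {s..t} \<longrightarrow> 0 < v r $ i"
      using ae by eventually_elim (use that in auto)
    then have "0 < integral {s..t} (\<lambda>r. v r $ i)"
      using that by (intro integral_pos_AE_lborel vi) auto
    then show ?thesis using inc[of s t i] that by simp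
  qed
  show "p $ 1 < q $ 1" "p $ 2 < q $ 2" using mono[of _ a b] ab(1) h(2,3) by auto
  have ae': "AE t in lborel. t \<in> {a..b} \<longrightarrow>
      p $ 1 < \<gamma> t $ 1 \<and> \<gamma> t $ 1 < q $ 1 \<and> p $ 2 < \<gamma> t $ 2 \<and> \<gamma> t $ 2 < q $ 2 \<and>
      0 < v t $ 2 \<and> v t $ 3 = f (\<gamma> t) * v t $ 2"
    using ae AE_lborel_singleton[of a] AE_lborel_singleton[of b]
  \<comment> \<open>The bounds on f are assumed only in the open rectangle; the two endpoint times
    are discarded as null sets.\<close>
  proof eventually_elim
    case (elim t)
    show ?case
    proof
      assume "t \<in> {a..b}"
      then show "p $ 1 < \<gamma> t $ 1 \<and> \<gamma> t $ 1 < q $ 1 \<and> p $ 2 < \<gamma> t $ 2 \<and> \<gamma> t $ 2 < q $ 2 \<and>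
          0 < v t $ 2 \<and> v t $ 3 = f (\<gamma> t) * v t $ 2"
        using elim mono[of _ a t] mono[of _ t b] h(2,3) by simp
    qed
  qed
  have inc3: "q $ 3 - p $ 3 = integral {a..b} (\<lambda>r. v r $ 3)" using inc[of a b 3] ab(1) h(2,3) by simp
  have "k * (q $ 2 - p $ 2) = k * integral {a..b} (\<lambda>r. v r $ 2)" using inc[of a b 2] ab(1) h(2,3) by simp
  then have inc2: "k * (q $ 2 - p $ 2) = integral {a..b} (\<lambda>r. k * v r $ 2)" by simp
  have vk: "(\<lambda>r. k * v r $ 2) integrable_on {a..b}"
    using integrable_cmul[OF vi[of a b 2], of k] ab(1) by simp
  show "q $ 3 - p $ 3 < k * (q $ 2 - p $ 2)"
    if "\<And>x. p $ 1 < x $ 1 \<Longrightarrow> x $ 1 < q $ 1 \<Longrightarrow> p $ 2 < x $ 2 \<Longrightarrow> x $ 2 < q $ 2 \<Longrightarrow> f x < k"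
  proof -
    have "AE r in lborel. r \<in> {a..b} \<longrightarrow> v r $ 3 < k * v r $ 2"
      using ae'
    proof eventually_elim
      case (elim r)
      then show ?case using that[of "\<gamma> r"] by simp
    qed
    then show ?thesis unfolding inc3 inc2
      using ab(1) by (intro integral_less_AE_lborel vi vk) auto
  qed
  show "k * (q $ 2 - p $ 2) < q $ 3 - p $ 3"
    if "\<And>x. p $ 1 < x $ 1 \<Longrightarrow> x $ 1 < q $ 1 \<Longrightarrow> p $ 2 < x $ 2 \<Longrightarrow> x $ 2 < q $ 2 \<Longrightarrow> k < f x"
  proof -
    have "AE r in lborel. r \<in> {a..b} \<longrightarrow> k * v r $ 2 < v r $ 3"
      using ae'
    proof eventually_elim
      case (elim r)
      then show ?case using that[of "\<gamma> r"] by simp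
    qed
    then show ?thesis unfolding inc3 inc2
      using ab(1) by (intro integral_less_AE_lborel vi vk) auto
  qed
qed

section \<open>Causality in the planar models\<close>

text \<open>An increasing function from 0 to 1 on the unit interval can have any mean m strictly
  between 0 and 1. The powers t^n have mean 1/(n+1) and the reflected functions 1 - (1-t)^n have
  mean n/(n+1); convex combinations fill the gap.\<close>

lemma increasing_profile:
  fixes m :: real
  assumes "0 < m" "m < 1"
  shows "\<exists>h h' H. (\<forall>t. (h has_real_derivative h' t) (at t)) \<and> (\<forall>t. (H has_real_derivative h t) (at t)) \<and>
    continuous_on UNIV h' \<and> (\<forall>t\<in>{0..1}. 0 < h' t) \<and> h 0 = 0 \<and> h 1 = 1 \<and> H 0 = 0 \<and> H 1 = m"
proof -
  \<comment> \<open>A large exponent puts m strictly between the two extreme means.\<close>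
  obtain n where n: "inverse (real (Suc n)) < min m (1 - m)"
    using reals_Archimedean[of "min m (1 - m)"] assms by auto
  define N where "N = real n"
  have N: "inverse (N + 1) < m" "inverse (N + 1) < 1 - m"
    using n by (simp_all add: N_def add.commute)
  then have "inverse (N + 1) < 1 / 2" by linarith
  then have N1: "1 < N" by (simp add: N_def field_simps)
  have m: "1 < m * (N + 1)" "m * (N + 1) < N"
    using N N1 by (simp_all add: field_simps)
  have n1: "1 < n" using N1 by (simp add: N_def)
  \<comment> \<open>The weight solving (l + (1 - l) N) / (N + 1) = m.\<close>
  define l where "l = (N - m * (N + 1)) / (N - 1)"
  have l: "0 < l" "l < 1" using N1 m by (simp_all add: l_def field_simps)
  define h where "h t = l * t ^ n + (1 - l) * (1 - (1 - t) ^ n)" for t :: real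
  define h' where "h' t = l * (N * t ^ (n - 1)) + (1 - l) * (N * (1 - t) ^ (n - 1))" for t :: real
  define P where "P t = t ^ (n + 1) / (N + 1)" for t :: real
  \<comment> \<open>The antiderivative of h; subtracting \<open>P 1\<close> makes it vanish at 0, so
    that \<open>H 1\<close> is the mean.\<close>
  define H where "H t = l * P t + (1 - l) * (t + (P (1 - t) - P 1))" for t :: real
  have "(h has_real_derivative h' t) (at t)" for t
    unfolding h_def h'_def N_def
    by (rule derivative_eq_intros refl | simp)+
  moreover have "(H has_real_derivative h t) (at t)" for t
  proof -
    have P: "(P has_real_derivative t ^ n) (at t)" for t
      unfolding P_def N_def
      by (rule derivative_eq_intros refl | simp add: add.commute)+
    have Q: "((\<lambda>t. P (1 - t)) has_real_derivative (1 - t) ^ n * (- 1)) (at t)" for t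
      by (rule DERIV_chain2[OF P]) (auto intro!: derivative_eq_intros)
    show ?thesis
      unfolding h_def H_def by (rule derivative_eq_intros P Q refl | simp)+
  qed
  moreover have "continuous_on UNIV h'"
    unfolding h'_def by (intro continuous_intros)
  moreover have "0 < h' t" if "t \<in> {0..1}" for t
  \<comment> \<open>At 0 only the reflected summand has positive derivative; elsewhere the power
    summand already suffices.\<close>
  proof (cases "t = 0")
    case True
    then show ?thesis using l N1 n1 by (simp add: h'_def power_0_left)
  next
    case False
    then have "0 < l * (N * t ^ (n - 1))" using that l N1 by simp
    moreover have "0 \<le> (1 - l) * (N * (1 - t) ^ (n - 1))" using that l N1 by simp
    ultimately show ?thesis by (simp add: h'_def)
  qed
  moreover have "h 0 = 0" "h 1 = 1" "H 0 = 0" using n1 by (simp_all add: h_def H_def P_def power_0_left)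
  moreover have "H 1 = m"
  proof -
    have "1 - 1 / (N + 1) = N / (N + 1)" using N1 by (simp add: field_simps)
    then have "H 1 = l * (1 / (N + 1)) + (1 - l) * (N / (N + 1))" by (simp add: H_def P_def)
    also have "\<dots> = (l + (1 - l) * N) / (N + 1)" by (simp add: add_divide_distrib)
    also have "l + (1 - l) * N = N - l * (N - 1)" by (simp add: algebra_simps)
    also have "l * (N - 1) = N - m * (N + 1)" using N1 by (simp add: l_def)
    finally show ?thesis using N1 by simp
  qed
  ultimately show ?thesis by blast
qed

text \<open>The average of x with respect to y along the curve is the quotient of the gains in
  height and in y. It lies strictly between the end values of x, and every such average is
  attained.\<close>

lemma chron_model_nth_1_iff:
  "chron_model 0 (\<lambda>x. x $ 1) p q \<longleftrightarrow> p \<in> space3 \<and> q \<in> space3 \<and> p $ 1 < q $ 1 \<and> p $ 2 < q $ 2 \<and>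
    p $ 1 * (q $ 2 - p $ 2) < q $ 3 - p $ 3 \<and> q $ 3 - p $ 3 < q $ 1 * (q $ 2 - p $ 2)"
    (is "?L \<longleftrightarrow> ?R")
proof
  assume ?L
  then show ?R
    using chron_model_0_less[of "\<lambda>x. x $ 1" p q] chron_in[of "model 0"] by (auto simp: model_0)
next
  assume R: ?R
  define X Y where "X = q $ 1 - p $ 1" and "Y = q $ 2 - p $ 2"
  have XY: "0 < X" "0 < Y" using R by (simp_all add: X_def Y_def)
  \<comment> \<open>The required mean of the x-profile, rescaled to the unit interval, for a curve
    along which y is affine in time.\<close>
  define m where "m = ((q $ 3 - p $ 3) / Y - p $ 1) / X"
  have "p $ 1 < (q $ 3 - p $ 3) / Y" "(q $ 3 - p $ 3) / Y < q $ 1"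
    using R XY by (simp_all add: Y_def[symmetric] field_simps)
  then have m: "0 < m" "m < 1" using XY by (simp_all add: m_def X_def field_simps)
  have z: "p $ 3 + Y * (p $ 1 + X * m) = q $ 3" using XY by (simp add: m_def)
  obtain h h' H where h: "\<And>t. (h has_real_derivative h' t) (at t)" "\<And>t. (H has_real_derivative h t) (at t)"
    "continuous_on UNIV h'" "\<And>t. t\<in>{0..1} \<Longrightarrow> 0 < h' t" "h 0 = 0" "h 1 = 1" "H 0 = 0" "H 1 = m"
    using increasing_profile[OF m] by blast
  have ch: "continuous_on A h" for A
    by (meson h(1) DERIV_continuous continuous_at_imp_continuous_on)
  have curve: "htfd_curve (model 0) (model_plane 0 (\<lambda>x. x $ 1)) (model_metric 0) (model_time 0 (\<lambda>x. x $ 1)) 0 1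
      (\<lambda>t. vec3 (p $ 1 + X * h t) (p $ 2 + Y * t) (p $ 3 + Y * (p $ 1 * t + X * H t)))"
  proof (rule htfd_curve_vec3)
    show "((\<lambda>t. p $ 1 + X * h t) has_real_derivative X * h' t) (at t)" for t
      by (rule derivative_eq_intros h refl | simp)+
    show "((\<lambda>t. p $ 2 + Y * t) has_real_derivative Y) (at t)" for t
      by (rule derivative_eq_intros refl | simp)+
    show "((\<lambda>t. p $ 3 + Y * (p $ 1 * t + X * H t)) has_real_derivative Y * (p $ 1 + X * h t)) (at t)" for t
      by (rule derivative_eq_intros h refl | simp)+
    show "continuous_on {0..1} (\<lambda>t. X * h' t)"
      by (intro continuous_intros continuous_on_subset[OF h(3)]) simp
  qed (use XY h(4) in \<open>auto intro!: continuous_intros ch\<close>)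
  have "vec3 (p $ 1) (p $ 2) (p $ 3) = p" "vec3 (q $ 1) (q $ 2) (q $ 3) = q"
    using R vec3_eta by auto
  then show ?L
    using h(5-8) z by (intro chronI[OF curve]) (auto simp: X_def Y_def)
qed

text \<open>Diamonds are spanned by two points on a timelike curve over the diagonal direction
  through p. Monotone coordinates confine x and y, and the local bound on f then confines the
  height.\<close>

lemma alexandrov_finer_plane:
  fixes f :: "ambient \<Rightarrow> real"
  assumes bound: "\<And>p :: ambient. \<exists>K>0. \<forall>x. \<bar>x $ 1 - p $ 1\<bar> < 1 \<longrightarrow> \<bar>x $ 2 - p $ 2\<bar> < 1 \<longrightarrow> \<bar>f x\<bar> < K"
    and diag: "\<And>p :: ambient. \<exists>h h'. h 0 = 0 \<and> continuous_on UNIV h' \<and>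
      (\<forall>t. (h has_real_derivative h' t) (at t)) \<and> (\<forall>t z. f (vec3 (p $ 1 + t) (p $ 2 + t) z) = h' t)"
  shows "Collect (openin (top_of_set (model 0))) \<subseteq>
    Collect (openin (alexandrov_topology (model 0) (model_plane 0 f) (model_metric 0) (model_time 0 f)))"
proof (rule alexandrov_finer)
  fix p :: ambient and e :: real assume p: "p \<in> model 0" and "0 < e"
  obtain K where K: "K > 0" "\<And>x. \<bar>x $ 1 - p $ 1\<bar> < 1 \<Longrightarrow> \<bar>x $ 2 - p $ 2\<bar> < 1 \<Longrightarrow> \<bar>f x\<bar> < K"
    using bound[of p] by blast
  obtain h h' where h: "h 0 = 0" "continuous_on UNIV h'" "\<And>t. (h has_real_derivative h' t) (at t)"
    "\<And>t z. f (vec3 (p $ 1 + t) (p $ 2 + t) z) = h' t"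
    using diag[of p] by blast
  define \<gamma> where "\<gamma> t = vec3 (p $ 1 + t) (p $ 2 + t) (p $ 3 + h t)" for t
  have \<gamma>0: "\<gamma> 0 = p" using p vec3_eta[of p] by (simp add: \<gamma>_def h(1) model_0)
  have chron_model: "chron_model 0 f (\<gamma> a) (\<gamma> b)" if "a < b" for a b
  proof -
    have "htfd_curve (model 0) (model_plane 0 f) (model_metric 0) (model_time 0 f) a b \<gamma>"
      unfolding \<gamma>_def
    proof (rule htfd_curve_vec3[OF that])
      show "((\<lambda>t. p $ 1 + t) has_real_derivative 1) (at t)" "((\<lambda>t. p $ 2 + t) has_real_derivative 1) (at t)" for t
        by (auto intro!: derivative_eq_intros)
      show "((\<lambda>t. p $ 3 + h t) has_real_derivative h' t) (at t)" for t
        by (rule derivative_eq_intros h(3) refl | simp)+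
    qed (auto simp: h(4) intro!: continuous_intros continuous_on_subset[OF h(2)])
    then show ?thesis unfolding chron_def by blast
  qed
  \<comment> \<open>The bound 1/2 keeps the diamond where K bounds f. The factor 2 + 3 K adds d for
    each planar coordinate and 3 K d for the height.\<close>
  define d where "d = min (1 / 2) (e / (2 + 3 * K))"
  have d: "0 < d" "d < 1" using \<open>0 < e\<close> K(1) by (auto simp: d_def)
  have "d * (2 + 3 * K) \<le> e / (2 + 3 * K) * (2 + 3 * K)"
    using K(1) by (intro mult_right_mono) (auto simp: d_def)
  also have "\<dots> = e" using K(1) by simp
  finally have de: "d * (2 + 3 * K) \<le> e" .
  have height: "\<bar>y $ 3 - x $ 3\<bar> < K * (y $ 2 - x $ 2)"
    if "chron_model 0 f x y" "p $ 1 - d \<le> x $ 1" "y $ 1 \<le> p $ 1 + d" "p $ 2 - d \<le> x $ 2" "y $ 2 \<le> p $ 2 + d" for x y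
  proof -
    have b: "\<bar>f w\<bar> < K" if "x $ 1 < w $ 1" "w $ 1 < y $ 1" "x $ 2 < w $ 2" "w $ 2 < y $ 2" for w
      using that \<open>p $ 1 - d \<le> x $ 1\<close> \<open>y $ 1 \<le> p $ 1 + d\<close> \<open>p $ 2 - d \<le> x $ 2\<close> \<open>y $ 2 \<le> p $ 2 + d\<close> d
      by (intro K(2)) (auto simp: abs_less_iff)
    have "y $ 3 - x $ 3 < K * (y $ 2 - x $ 2)"
      by (rule chron_model_0_less(3)[OF that(1)]) (use b in \<open>simp add: abs_less_iff\<close>)
    moreover have lo: "- K * (y $ 2 - x $ 2) < y $ 3 - x $ 3"
      by (rule chron_model_0_less(4)[OF that(1)]) (use b in \<open>fastforce simp: abs_less_iff\<close>)
    moreover from lo have "- (K * (y $ 2 - x $ 2)) < y $ 3 - x $ 3" by simp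
    ultimately show ?thesis by linarith
  qed
  show "\<exists>q r. chron_model 0 f q p \<and> chron_model 0 f p r \<and> (\<forall>x. chron_model 0 f q x \<longrightarrow> chron_model 0 f x r \<longrightarrow> dist x p < e)"
  proof (intro exI conjI allI impI)
    show qp: "chron_model 0 f (\<gamma> (- d)) p" and "chron_model 0 f p (\<gamma> d)"
      using chron_model[of "- d" 0] chron_model[of 0 d] d \<gamma>0 by auto
    fix x assume x: "chron_model 0 f (\<gamma> (- d)) x" "chron_model 0 f x (\<gamma> d)"
    have c: "p $ 1 - d < x $ 1" "p $ 2 - d < x $ 2" "x $ 1 < p $ 1 + d" "x $ 2 < p $ 2 + d"
      using chron_model_0_less(1,2)[OF x(1)] chron_model_0_less(1,2)[OF x(2)] by (simp_all add: \<gamma>_def)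
    \<comment> \<open>Heights are compared through the lower vertex: x differs from it by less than
      2 K d and p by less than K d.\<close>
    have 1: "\<bar>x $ 3 - \<gamma> (- d) $ 3\<bar> < K * (x $ 2 - (p $ 2 - d))"
      using height[OF x(1)] c by (simp add: \<gamma>_def)
    have 2: "\<bar>p $ 3 - \<gamma> (- d) $ 3\<bar> < K * d"
      using height[OF qp] d by (simp add: \<gamma>_def)
    have "K * (x $ 2 - (p $ 2 - d)) \<le> K * (2 * d)" using c K(1) by (intro mult_left_mono) auto
    with 1 2 have 3: "\<bar>x $ 3 - p $ 3\<bar> < 3 * (K * d)" by (simp add: abs_less_iff)
    have "x \<in> space3" "p \<in> space3" using chron_in(1)[OF x(2)] p by (simp_all add: model_0)
    then have "x - p = vec3 (x $ 1 - p $ 1) (x $ 2 - p $ 2) (x $ 3 - p $ 3)"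
      using vec3_eta subspace_diff[OF subspace_space3] by (metis vector_minus_component)
    then have "norm (x - p) \<le> \<bar>x $ 1 - p $ 1\<bar> + \<bar>x $ 2 - p $ 2\<bar> + \<bar>x $ 3 - p $ 3\<bar>"
      using norm_vec3 by metis
    also have "\<dots> < d + d + 3 * (K * d)" using c 3 by linarith
    also have "\<dots> \<le> e" using de by (simp add: algebra_simps)
    finally show "dist x p < e" by (simp add: dist_norm)
  qed
qed

section \<open>Causality in the annular models\<close>

text \<open>With the logarithm of the radius as coordinate, the radial and angular fields both have
  constant components.\<close>

definition polar :: "real \<Rightarrow> real \<Rightarrow> real \<Rightarrow> ambient" where
  "polar \<sigma> \<theta> z = vec3 (exp \<sigma> * cos \<theta>) (exp \<sigma> * sin \<theta>) z"

lemma frame_sq_1: "frame_sq 1 x = 2 * ((x $ 1)\<^sup>2 + (x $ 2)\<^sup>2)"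
  by (simp add: frame_sq_def frame_re_def frame_im_def power2_eq_square algebra_simps)

lemma polar_radius: "(polar \<sigma> \<theta> z $ 1)\<^sup>2 + (polar \<sigma> \<theta> z $ 2)\<^sup>2 = (exp \<sigma>)\<^sup>2"
proof -
  have "(polar \<sigma> \<theta> z $ 1)\<^sup>2 + (polar \<sigma> \<theta> z $ 2)\<^sup>2 = (exp \<sigma>)\<^sup>2 * (cos \<theta>)\<^sup>2 + (exp \<sigma>)\<^sup>2 * (sin \<theta>)\<^sup>2"
    by (simp add: polar_def power_mult_distrib)
  also have "\<dots> = (exp \<sigma>)\<^sup>2 * ((cos \<theta>)\<^sup>2 + (sin \<theta>)\<^sup>2)"
    by (rule distrib_left[symmetric])
  finally show ?thesis by simp
qed

lemma frame_sq_polar: "frame_sq 1 (polar \<sigma> \<theta> z) = 2 * (exp \<sigma>)\<^sup>2"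
  unfolding frame_sq_1 polar_radius ..

lemma polar_in_model: "polar \<sigma> \<theta> z \<in> model 1"
  by (simp add: model_def model_dom_def frame_sq_polar) (simp add: polar_def)

lemma model_1_polar:
  assumes "p \<in> model 1"
  obtains \<sigma> \<theta> z where "p = polar \<sigma> \<theta> z"
proof -
  define r where "r = sqrt ((p $ 1)\<^sup>2 + (p $ 2)\<^sup>2)"
  have pos: "0 < (p $ 1)\<^sup>2 + (p $ 2)\<^sup>2" using model_frame_sq[OF assms] by (simp add: frame_sq_1)
  then have r: "0 < r" "r\<^sup>2 = (p $ 1)\<^sup>2 + (p $ 2)\<^sup>2" by (simp_all add: r_def)
  have "(p $ 1 / r)\<^sup>2 + (p $ 2 / r)\<^sup>2 = ((p $ 1)\<^sup>2 + (p $ 2)\<^sup>2) / r\<^sup>2"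
    by (simp add: power_divide add_divide_distrib)
  also have "\<dots> = r\<^sup>2 / r\<^sup>2" by (simp only: r(2))
  finally have "(p $ 1 / r)\<^sup>2 + (p $ 2 / r)\<^sup>2 = r\<^sup>2 / r\<^sup>2" .
  then have "(p $ 1 / r)\<^sup>2 + (p $ 2 / r)\<^sup>2 = 1" using r(1) by simp
  then obtain \<theta> where "p $ 1 / r = cos \<theta>" "p $ 2 / r = sin \<theta>" by (rule sincos_total_2pi)
  then have "p $ 1 = exp (ln r) * cos \<theta>" "p $ 2 = exp (ln r) * sin \<theta>"
    using r by (simp_all add: field_simps)
  then have "p = polar (ln r) \<theta> (p $ 3)"
    using vec3_eta[OF model_space3[OF assms]] by (simp add: polar_def)
  then show ?thesis using that by blast
qed

lemma connected_model_1: "connected (model 1)"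
proof -
  have "model 1 = (\<lambda>(\<sigma>, \<theta>, z). polar \<sigma> \<theta> z) ` UNIV"
  proof (intro set_eqI iffI)
    fix p assume "p \<in> model 1"
    then obtain \<sigma> \<theta> z where "p = polar \<sigma> \<theta> z" by (rule model_1_polar)
    then show "p \<in> (\<lambda>(\<sigma>, \<theta>, z). polar \<sigma> \<theta> z) ` UNIV" by (intro image_eqI[of _ _ "(\<sigma>, \<theta>, z)"]) simp_all
  qed (auto simp: polar_in_model)
  moreover have "connected ((\<lambda>(\<sigma>, \<theta>, z). polar \<sigma> \<theta> z) ` UNIV)"
    unfolding polar_def vec3_def case_prod_beta
    by (intro connected_continuous_image continuous_intros connected_UNIV)
  ultimately show ?thesis by simp
qed

text \<open>Up to the factor \<open>exp \<sigma>\<close> squared, the null forms are \<theta>' +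
  \<sigma>' and \<theta>' - \<sigma>': the planar part is conformal to a flat Lorentzian cylinder
  with periodic time \<theta>.\<close>

lemma alpha_beta_polar:
  fixes \<sigma>' \<theta>' z' :: real
  defines "v \<equiv> \<lambda>\<sigma> \<theta>. vec3 (exp \<sigma> * (\<sigma>' * cos \<theta> - \<theta>' * sin \<theta>)) (exp \<sigma> * (\<sigma>' * sin \<theta> + \<theta>' * cos \<theta>)) z'"
  shows "alpha 1 (polar \<sigma> \<theta> z) (v \<sigma> \<theta>) = (exp \<sigma>)\<^sup>2 * (\<theta>' + \<sigma>')"
    "beta 1 (polar \<sigma> \<theta> z) (v \<sigma> \<theta>) = (exp \<sigma>)\<^sup>2 * (\<theta>' - \<sigma>')"
proof -
  have *: "(e * c - e * s) * (e * (u * c - w * s)) + (e * c + e * s) * (e * (u * s + w * c)) = e\<^sup>2 * (w + u)"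
    "- (e * c + e * s) * (e * (u * c - w * s)) + (e * c - e * s) * (e * (u * s + w * c)) = e\<^sup>2 * (w - u)"
    if "s\<^sup>2 + c\<^sup>2 = 1" for s c e u w :: real
    using that by algebra+
  show "alpha 1 (polar \<sigma> \<theta> z) (v \<sigma> \<theta>) = (exp \<sigma>)\<^sup>2 * (\<theta>' + \<sigma>')"
    "beta 1 (polar \<sigma> \<theta> z) (v \<sigma> \<theta>) = (exp \<sigma>)\<^sup>2 * (\<theta>' - \<sigma>')"
    using *[OF sin_cos_squared_add, of "exp \<sigma>" \<theta> \<sigma>' \<theta>']
    by (simp_all only: v_def alpha_def beta_def frame_re_def frame_im_def polar_def vec3_nth mult_1 diff_self add_0)
qed

lemma htfd_curve_polar:
  assumes "a < b"
    and d: "\<And>t. (\<sigma> has_real_derivative \<sigma>' t) (at t)" "\<And>t. (\<theta> has_real_derivative \<theta>' t) (at t)"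
      "\<And>t. (z has_real_derivative z' t) (at t)"
    and c: "continuous_on {a..b} \<sigma>'" "continuous_on {a..b} \<theta>'" "continuous_on {a..b} z'"
    and tl: "\<And>t. t \<in> {a..b} \<Longrightarrow> \<bar>\<sigma>' t\<bar> < \<theta>' t"
    and hor: "\<And>t. t \<in> {a..b} \<Longrightarrow> 2 * z' t = f (polar (\<sigma> t) (\<theta> t) (z t)) * (\<theta>' t - \<sigma>' t)"
  shows "htfd_curve (model 1) (model_plane 1 f) (model_metric 1) (model_time 1 f) a b (\<lambda>t. polar (\<sigma> t) (\<theta> t) (z t))"
  unfolding polar_def
proof (rule htfd_curve_vec3[OF \<open>a < b\<close>], unfold polar_def[symmetric])
  show "((\<lambda>t. exp (\<sigma> t) * cos (\<theta> t)) has_real_derivative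
      exp (\<sigma> t) * (\<sigma>' t * cos (\<theta> t) - \<theta>' t * sin (\<theta> t))) (at t)" for t
    by (rule derivative_eq_intros d refl | simp add: algebra_simps)+
  show "((\<lambda>t. exp (\<sigma> t) * sin (\<theta> t)) has_real_derivative
      exp (\<sigma> t) * (\<sigma>' t * sin (\<theta> t) + \<theta>' t * cos (\<theta> t))) (at t)" for t
    by (rule derivative_eq_intros d refl | simp add: algebra_simps)+
  have cc: "continuous_on {a..b} \<sigma>" "continuous_on {a..b} \<theta>"
    by (meson d DERIV_continuous continuous_at_imp_continuous_on)+
  show "continuous_on {a..b} (\<lambda>t. exp (\<sigma> t) * (\<sigma>' t * cos (\<theta> t) - \<theta>' t * sin (\<theta> t)))"
    "continuous_on {a..b} (\<lambda>t. exp (\<sigma> t) * (\<sigma>' t * sin (\<theta> t) + \<theta>' t * cos (\<theta> t)))"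
    by (intro continuous_intros c cc)+
  fix t assume t: "t \<in> {a..b}"
  have "0 < \<theta>' t + \<sigma>' t" "0 < \<theta>' t - \<sigma>' t" using tl[OF t] by (auto simp: abs_less_iff)
  then show "0 < alpha 1 (polar (\<sigma> t) (\<theta> t) (z t)) (vec3 (exp (\<sigma> t) * (\<sigma>' t * cos (\<theta> t) - \<theta>' t * sin (\<theta> t)))
      (exp (\<sigma> t) * (\<sigma>' t * sin (\<theta> t) + \<theta>' t * cos (\<theta> t))) (z' t))"
    "0 < beta 1 (polar (\<sigma> t) (\<theta> t) (z t)) (vec3 (exp (\<sigma> t) * (\<sigma>' t * cos (\<theta> t) - \<theta>' t * sin (\<theta> t)))
      (exp (\<sigma> t) * (\<sigma>' t * sin (\<theta> t) + \<theta>' t * cos (\<theta> t))) (z' t))"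
    unfolding alpha_beta_polar by (intro mult_pos_pos; simp)+
  show "frame_sq 1 (polar (\<sigma> t) (\<theta> t) (z t)) * z' t = f (polar (\<sigma> t) (\<theta> t) (z t)) *
    beta 1 (polar (\<sigma> t) (\<theta> t) (z t)) (vec3 (exp (\<sigma> t) * (\<sigma>' t * cos (\<theta> t) - \<theta>' t * sin (\<theta> t)))
      (exp (\<sigma> t) * (\<sigma>' t * sin (\<theta> t) + \<theta>' t * cos (\<theta> t))) (z' t))"
  proof -
    have "frame_sq 1 (polar (\<sigma> t) (\<theta> t) (z t)) * z' t = (exp (\<sigma> t))\<^sup>2 * (2 * z' t)"
      by (simp add: frame_sq_polar)
    then show ?thesis unfolding alpha_beta_polar hor[OF t] by (simp add: mult.left_commute)
  qed
qed (use d c frame_sq_polar in auto)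

section \<open>Reachability by winding around the origin\<close>

definition log_radius :: "ambient \<Rightarrow> real" where
  "log_radius x = ln ((x $ 1)\<^sup>2 + (x $ 2)\<^sup>2) / 2"

lemma log_radius_polar: "log_radius (polar \<sigma> \<theta> z) = \<sigma>"
  unfolding log_radius_def polar_radius by (simp add: ln_realpow)

lemma polar_periodic: "polar \<sigma> (\<theta> + 2 * pi * real n) z = polar \<sigma> \<theta> z"
  using cos.plus_of_nat[of \<theta> n] sin.plus_of_nat[of \<theta> n]
  by (simp add: polar_def mult_ac)

text \<open>Parametrised by angle, the height satisfies z' = \<sigma> (1 - \<sigma>') / 2, so its
  gain depends only on the end values and on the integral of \<sigma>. Extra turns lengthen the time
  available, which lets \<sigma> reach any prescribed integral with |\<sigma>'| < 1.\<close>

lemma chron_model_log_radius: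
  assumes "p \<in> model 1" "q \<in> model 1"
  shows "chron_model 1 log_radius p q"
proof -
  obtain \<sigma>0 \<theta>0 z0 where p: "p = polar \<sigma>0 \<theta>0 z0" using model_1_polar[OF assms(1)] .
  obtain \<sigma>1 \<theta>1 z1 where q: "q = polar \<sigma>1 \<theta>1 z1" using model_1_polar[OF assms(2)] .
  define s where "s = \<sigma>1 - \<sigma>0"
  \<comment> \<open>The value that the integral of \<sigma> must take for the curve to end at height
    \<open>z1\<close>.\<close>
  define w where "w = 2 * (z1 - z0) + (\<sigma>1\<^sup>2 - \<sigma>0\<^sup>2) / 2"
  \<comment> \<open>A bound for |c| that does not depend on L once L > 1, so that L can be chosen
    afterwards.\<close>
  define C where "C = 6 * \<bar>w\<bar> + 3 * \<bar>\<sigma>0 + \<sigma>1\<bar>"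
  obtain n :: nat where n: "(1 + \<bar>s\<bar> + C + \<theta>0 - \<theta>1) / (2 * pi) < real n"
    using reals_Archimedean2 by blast
  define L where "L = \<theta>1 - \<theta>0 + 2 * pi * real n"
  have L: "1 + \<bar>s\<bar> + C < L" using n by (simp add: L_def field_simps)
  have "0 \<le> C" by (simp add: C_def)
  with L have L1: "1 < L" by linarith
  \<comment> \<open>The bump t (L - t) / L^2 has integral L / 6; this coefficient makes up what
    linear interpolation lacks of the integral \<open>w\<close>.\<close>
  define c where "c = 6 * w / L - 3 * (\<sigma>0 + \<sigma>1)"
  define \<sigma> where "\<sigma> t = \<sigma>0 + s * t / L + c * t * (L - t) / L\<^sup>2" for t
  define \<sigma>' where "\<sigma>' t = s / L + c * (L - 2 * t) / L\<^sup>2" for t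
  \<comment> \<open>The antiderivative of \<sigma>. The height then integrates in closed form
    because \<sigma> \<sigma>' is half the derivative of \<sigma>^2.\<close>
  define S where "S t = \<sigma>0 * t + s * t\<^sup>2 / (2 * L) + c * (t\<^sup>2 / (2 * L) - t ^ 3 / (3 * L\<^sup>2))" for t
  define z where "z t = z0 + S t / 2 - ((\<sigma> t)\<^sup>2 - \<sigma>0\<^sup>2) / 4" for t
  have d\<sigma>: "(\<sigma> has_real_derivative \<sigma>' t) (at t)" for t
    unfolding \<sigma>_def \<sigma>'_def using L1
    by (auto intro!: derivative_eq_intros simp: field_simps power2_eq_square)
  have dS: "(S has_real_derivative \<sigma> t) (at t)" for t
    unfolding \<sigma>_def S_def using L1
    by (auto intro!: derivative_eq_intros simp: field_simps power2_eq_square)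
  have dz: "(z has_real_derivative \<sigma> t * (1 - \<sigma>' t) / 2) (at t)" for t
    unfolding z_def by (rule derivative_eq_intros d\<sigma> dS refl | simp add: field_simps)+
  have c\<sigma>: "continuous_on A \<sigma>" for A
    by (meson d\<sigma> DERIV_continuous continuous_at_imp_continuous_on)
  have c\<sigma>': "continuous_on A \<sigma>'" for A
    unfolding \<sigma>'_def using L1 by (intro continuous_intros) auto
  have cC: "\<bar>c\<bar> \<le> C"
  proof -
    have "\<bar>6 * w / L\<bar> = \<bar>6 * w\<bar> / L" using L1 by (simp add: abs_divide)
    also have "\<dots> \<le> \<bar>6 * w\<bar> / 1" using L1 by (intro divide_left_mono) auto
    finally have "\<bar>6 * w / L\<bar> \<le> 6 * \<bar>w\<bar>" by (simp add: abs_mult)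
    moreover have "\<bar>x - 3 * y\<bar> \<le> 6 * \<bar>w\<bar> + 3 * \<bar>y\<bar>" if "\<bar>x\<bar> \<le> 6 * \<bar>w\<bar>" for x y
      using that by linarith
    ultimately show ?thesis unfolding c_def C_def by blast
  qed
  have tl: "\<bar>\<sigma>' t\<bar> < 1" if "t \<in> {0..L}" for t
  proof -
    have "\<bar>c * (L - 2 * t)\<bar> \<le> C * L"
      unfolding abs_mult using that cC by (intro mult_mono) auto
    then have "\<bar>c * (L - 2 * t) / L\<^sup>2\<bar> \<le> C * L / L\<^sup>2"
      by (simp add: abs_divide divide_right_mono)
    also have "\<dots> = C / L" by (simp add: power2_eq_square)
    finally have "\<bar>\<sigma>' t\<bar> \<le> \<bar>s / L\<bar> + C / L"
      unfolding \<sigma>'_def by (intro order_trans[OF abs_triangle_ineq] add_left_mono)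
    also have "\<dots> = (\<bar>s\<bar> + C) / L" using L1 by (simp add: add_divide_distrib)
    also have "\<dots> < 1" using L L1 by simp
    finally show ?thesis .
  qed
  have curve: "htfd_curve (model 1) (model_plane 1 log_radius) (model_metric 1) (model_time 1 log_radius) 0 L
      (\<lambda>t. polar (\<sigma> t) (\<theta>0 + t) (z t))"
  proof (rule htfd_curve_polar[where \<theta>' = "\<lambda>_. 1", OF _ d\<sigma> _ dz])
    show "((+) \<theta>0 has_real_derivative 1) (at t)" for t
      by (auto intro!: derivative_eq_intros)
  qed (use L1 tl in \<open>auto simp: log_radius_polar intro!: continuous_intros c\<sigma> c\<sigma>'\<close>)
  have "\<sigma> 0 = \<sigma>0" "z 0 = z0" by (simp_all add: \<sigma>_def z_def S_def)
  moreover have \<sigma>L: "\<sigma> L = \<sigma>1" using L1 by (simp add: \<sigma>_def s_def)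
  moreover have "z L = z1"
  proof -
    have "S L = L * (\<sigma>0 + s / 2 + c / 6)" using L1 by (simp add: S_def field_simps power2_eq_square power3_eq_cube)
    also have "\<sigma>0 + s / 2 + c / 6 = w / L" by (simp add: s_def c_def field_simps)
    also have "L * (w / L) = w" using L1 by simp
    finally show ?thesis by (simp add: z_def \<sigma>L w_def field_simps)
  qed
  moreover have "polar \<sigma>1 (\<theta>0 + L) z1 = q" using polar_periodic[of \<sigma>1 \<theta>1 n z1] by (simp add: L_def q)
  ultimately show ?thesis by (intro chronI[OF curve]) (simp_all add: p)
qed

section \<open>The four examples\<close>

lemma model_0_nonempty_connected: "model 0 \<noteq> {}" "connected (model 0)"
  using subspace_0[OF subspace_space3] subspace_imp_convex[OF subspace_space3, THEN convex_connected]
  by (auto simp: model_0)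

lemma model_1_nonempty_connected: "model 1 \<noteq> {}" "connected (model 1)"
  using polar_in_model connected_model_1 by blast+

lemma sub_spacetime_plane:
  assumes "bounded_linear s" "s (vec3 1 0 0) = 1" "f = s \<or> f = (\<lambda>x. (s x)\<^sup>2)"
  shows "sub_spacetime (model 0) (model_plane 0 f) (model_metric 0) (model_time 0 f)"
proof (rule sub_spacetime_frame[OF _ _ assms(3) model_0_nonempty_connected])
  show "smooth_on (model_dom 0) s" by (rule smooth_on_bounded_linear[OF open_model_dom assms(1)])
  show "frechet_derivative s (at x) (frameR 0 x) = 1" for x
    unfolding frechet_derivative_at[OF bounded_linear_imp_has_derivative[OF assms(1)], symmetric]
    by (simp add: frameR_def assms(2))
qed

text \<open>The angular part of R preserves the radius and its radial part scales it at unit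
  logarithmic rate, so R(\<sigma>) = 1.\<close>

lemma sub_spacetime_annulus:
  assumes "f = log_radius \<or> f = (\<lambda>x. (log_radius x)\<^sup>2)"
  shows "sub_spacetime (model 1) (model_plane 1 f) (model_metric 1) (model_time 1 f)"
proof (rule sub_spacetime_frame[OF _ _ assms model_1_nonempty_connected])
  have pos: "0 < (x $ 1)\<^sup>2 + (x $ 2)\<^sup>2" if "x \<in> model_dom 1" for x
    using that by (simp add: model_dom_def frame_sq_1)
  have "smooth_on (model_dom 1) (\<lambda>x. (1 / 2) * ln ((x $ 1)\<^sup>2 + (x $ 2)\<^sup>2))"
    using pos by (intro smooth_on_mult smooth_on_const smooth_on_ln smooth_on_add smooth_on_power2
        smooth_on_component open_model_dom) auto
  then show "smooth_on (model_dom 1) log_radius" by (simp add: log_radius_def[abs_def])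
  fix x :: ambient assume "x \<in> model_dom 1"
  note x = pos[OF this]
  have n: "((\<lambda>x. x $ i) has_derivative (\<lambda>v. v $ i)) (at x)" for i :: 10
    by (rule bounded_linear_imp_has_derivative[OF bounded_linear_vec_nth])
  have "(log_radius has_derivative (\<lambda>v. (x $ 1 * v $ 1 + x $ 2 * v $ 2) / ((x $ 1)\<^sup>2 + (x $ 2)\<^sup>2))) (at x)"
  proof -
    have "(x $ 1)\<^sup>2 + (x $ 2)\<^sup>2 \<noteq> 0" "4 * (x $ 1)\<^sup>2 + 4 * (x $ 2)\<^sup>2 \<noteq> 0" using x by linarith+
    then show ?thesis
      unfolding log_radius_def[abs_def] using x
      by (auto intro!: derivative_eq_intros n simp: fun_eq_iff divide_simps) algebra+
  qed
  from frechet_derivative_at[OF this, symmetric]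
  have "frechet_derivative log_radius (at x) (frameR 1 x) =
      (x $ 1 * (x $ 1 - x $ 2) + x $ 2 * (x $ 1 + x $ 2)) / ((x $ 1)\<^sup>2 + (x $ 2)\<^sup>2)"
    by (simp add: frameR_def frame_re_def frame_im_def)
  also have "x $ 1 * (x $ 1 - x $ 2) + x $ 2 * (x $ 1 + x $ 2) = (x $ 1)\<^sup>2 + (x $ 2)\<^sup>2"
    by algebra
  finally show "frechet_derivative log_radius (at x) (frameR 1 x) = 1"
    using divide_self[OF less_imp_neq[OF x, symmetric]] by simp
qed

lemma alexandrov_eq_manifold:
  "top_of_set (model 0) = alexandrov_topology (model 0) (model_plane 0 (\<lambda>x. x $ 1)) (model_metric 0) (model_time 0 (\<lambda>x. x $ 1))"
proof -
  let ?f = "\<lambda>x :: ambient. x $ 1"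
  let ?A = "alexandrov_topology (model 0) (model_plane 0 ?f) (model_metric 0) (model_time 0 ?f)"
  have "Collect (openin ?A) \<subseteq> Collect (openin (top_of_set (model 0)))"
  proof (rule alexandrov_coarser)
    fix p :: ambient assume p: "p \<in> model 0"
    have "I_plus (model 0) (model_plane 0 ?f) (model_metric 0) (model_time 0 ?f) p =
      model 0 \<inter> {q. p $ 1 < q $ 1 \<and> p $ 2 < q $ 2 \<and>
        p $ 1 * (q $ 2 - p $ 2) < q $ 3 - p $ 3 \<and> q $ 3 - p $ 3 < q $ 1 * (q $ 2 - p $ 2)}"
      using p unfolding I_plus_def chron_model_nth_1_iff by (auto simp: model_0)
    moreover have "open {q :: ambient. p $ 1 < q $ 1 \<and> p $ 2 < q $ 2 \<and>
        p $ 1 * (q $ 2 - p $ 2) < q $ 3 - p $ 3 \<and> q $ 3 - p $ 3 < q $ 1 * (q $ 2 - p $ 2)}"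
      by (intro open_Collect_conj open_Collect_less continuous_intros)
    ultimately show "openin (top_of_set (model 0)) (I_plus (model 0) (model_plane 0 ?f) (model_metric 0) (model_time 0 ?f) p)"
      by (simp add: openin_open_Int)
    have "I_minus (model 0) (model_plane 0 ?f) (model_metric 0) (model_time 0 ?f) p =
      model 0 \<inter> {q. q $ 1 < p $ 1 \<and> q $ 2 < p $ 2 \<and>
        q $ 1 * (p $ 2 - q $ 2) < p $ 3 - q $ 3 \<and> p $ 3 - q $ 3 < p $ 1 * (p $ 2 - q $ 2)}"
      using p unfolding I_minus_def chron_model_nth_1_iff by (auto simp: model_0)
    moreover have "open {q :: ambient. q $ 1 < p $ 1 \<and> q $ 2 < p $ 2 \<and>
        q $ 1 * (p $ 2 - q $ 2) < p $ 3 - q $ 3 \<and> p $ 3 - q $ 3 < p $ 1 * (p $ 2 - q $ 2)}"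
      by (intro open_Collect_conj open_Collect_less continuous_intros)
    ultimately show "openin (top_of_set (model 0)) (I_minus (model 0) (model_plane 0 ?f) (model_metric 0) (model_time 0 ?f) p)"
      by (simp add: openin_open_Int)
  qed
  moreover have "Collect (openin (top_of_set (model 0))) \<subseteq> Collect (openin ?A)"
  proof (rule alexandrov_finer_plane)
    fix p :: ambient
    show "\<exists>K>0. \<forall>x::ambient. \<bar>x $ 1 - p $ 1\<bar> < 1 \<longrightarrow> \<bar>x $ 2 - p $ 2\<bar> < 1 \<longrightarrow> \<bar>x $ 1\<bar> < K"
      by (rule exI[of _ "\<bar>p $ 1\<bar> + 1"]) auto
    show "\<exists>h h'. h 0 = 0 \<and> continuous_on UNIV h' \<and> (\<forall>t. (h has_real_derivative h' t) (at t)) \<and>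
      (\<forall>t z. vec3 (p $ 1 + t) (p $ 2 + t) z $ 1 = h' t)"
      \<comment> \<open>Along the diagonal f = x is affine in time; the first witness is its
        antiderivative.\<close>
      by (rule exI[of _ "\<lambda>t. p $ 1 * t + t\<^sup>2 / 2"], rule exI[of _ "\<lambda>t. p $ 1 + t"])
        (auto intro!: derivative_eq_intros continuous_intros)
  qed
  ultimately show ?thesis by (simp add: topology_eq set_eq_iff subset_iff) blast
qed

text \<open>All futures and pasts are the whole manifold, so the Alexandrov topology is indiscrete
  and cannot separate two points.\<close>

lemma alexandrov_coarser_log_radius:
  "Collect (openin (alexandrov_topology (model 1) (model_plane 1 log_radius) (model_metric 1) (model_time 1 log_radius))) \<subset>
    Collect (openin (top_of_set (model 1)))"
proof -
  have "I_plus (model 1) (model_plane 1 log_radius) (model_metric 1) (model_time 1 log_radius) p = model 1"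
    "I_minus (model 1) (model_plane 1 log_radius) (model_metric 1) (model_time 1 log_radius) p = model 1" if "p \<in> model 1" for p
    using chron_model_log_radius chron_in that unfolding I_plus_def I_minus_def by blast+
  then have "Collect (openin (alexandrov_topology (model 1) (model_plane 1 log_radius) (model_metric 1) (model_time 1 log_radius))) \<subseteq>
    Collect (openin (top_of_set (model 1)))"
    by (intro alexandrov_coarser) simp_all
  moreover have "\<not> Collect (openin (top_of_set (model 1))) \<subseteq>
    Collect (openin (alexandrov_topology (model 1) (model_plane 1 log_radius) (model_metric 1) (model_time 1 log_radius)))"
  proof (rule alexandrov_not_finer[of "polar 0 0 0" _ "polar 0 0 1"])
    have "polar 0 0 0 $ 3 \<noteq> polar 0 0 1 $ 3" by (simp add: polar_def)
    then show "polar 0 0 0 \<noteq> polar 0 0 1" by metis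
  qed (auto simp: polar_in_model chron_model_log_radius)
  ultimately show ?thesis by blast
qed

text \<open>If q is reached from p without gaining height, it is a lowest point of the future of p,
  which therefore is not a neighbourhood of q.\<close>

lemma not_alexandrov_coarser:
  assumes "\<And>x. x \<in> model \<kappa> \<Longrightarrow> 0 \<le> f x" "chron_model \<kappa> f p q" "p $ 3 = q $ 3"
  shows "\<not> Collect (openin (alexandrov_topology (model \<kappa>) (model_plane \<kappa> f) (model_metric \<kappa>) (model_time \<kappa> f))) \<subseteq>
    Collect (openin (top_of_set (model \<kappa>)))"
proof -
  let ?S = "I_plus (model \<kappa>) (model_plane \<kappa> f) (model_metric \<kappa>) (model_time \<kappa> f) p"
  have "\<not> openin (top_of_set (model \<kappa>)) ?S"
  proof (rule not_open_above_height)
    show "q \<in> model \<kappa>" using chron_in(2)[OF assms(2)] .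
    show "q \<in> ?S" using assms(2) by (simp add: I_plus_def)
    show "q $ 3 \<le> x $ 3" if "x \<in> ?S" for x
    proof -
      have "chron_model \<kappa> f p x" using that by (simp add: I_plus_def)
      from chron_model_height_mono[OF assms(1) this] show ?thesis by (simp add: assms(3))
    qed
  qed
  moreover have "openin (alexandrov_topology (model \<kappa>) (model_plane \<kappa> f) (model_metric \<kappa>) (model_time \<kappa> f)) ?S"
    using chron_in(1)[OF assms(2)] by (rule openin_alexandrov_I_plus)
  ultimately show ?thesis by blast
qed

lemma manifold_coarser:
  fixes f :: "ambient \<Rightarrow> real"
  defines "f \<equiv> \<lambda>x. (x $ 1 - x $ 2)\<^sup>2"
  shows "Collect (openin (top_of_set (model 0))) \<subset>
    Collect (openin (alexandrov_topology (model 0) (model_plane 0 f) (model_metric 0) (model_time 0 f)))"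
proof -
  have "Collect (openin (top_of_set (model 0))) \<subseteq>
    Collect (openin (alexandrov_topology (model 0) (model_plane 0 f) (model_metric 0) (model_time 0 f)))"
  proof (rule alexandrov_finer_plane)
    fix p :: ambient
    have "\<bar>f x\<bar> < (\<bar>p $ 1 - p $ 2\<bar> + 2)\<^sup>2" if "\<bar>x $ 1 - p $ 1\<bar> < 1" "\<bar>x $ 2 - p $ 2\<bar> < 1" for x
    proof -
      \<comment> \<open>Each coordinate moves by less than 1, hence the difference by less than
        2.\<close>
      have "\<bar>x $ 1 - x $ 2\<bar> < \<bar>p $ 1 - p $ 2\<bar> + 2" using that by linarith
      then have "\<bar>x $ 1 - x $ 2\<bar>\<^sup>2 < (\<bar>p $ 1 - p $ 2\<bar> + 2)\<^sup>2" by (intro power_strict_mono) auto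
      then show ?thesis by (simp add: f_def)
    qed
    then show "\<exists>K>0. \<forall>x. \<bar>x $ 1 - p $ 1\<bar> < 1 \<longrightarrow> \<bar>x $ 2 - p $ 2\<bar> < 1 \<longrightarrow> \<bar>f x\<bar> < K"
      by (intro exI[of _ "(\<bar>p $ 1 - p $ 2\<bar> + 2)\<^sup>2"]) (auto intro: add_nonneg_pos)
    show "\<exists>h h'. h 0 = 0 \<and> continuous_on UNIV h' \<and> (\<forall>t. (h has_real_derivative h' t) (at t)) \<and>
      (\<forall>t z. f (vec3 (p $ 1 + t) (p $ 2 + t) z) = h' t)"
      by (rule exI[of _ "\<lambda>t. (p $ 1 - p $ 2)\<^sup>2 * t"], rule exI[of _ "\<lambda>t. (p $ 1 - p $ 2)\<^sup>2"])
        (auto intro!: derivative_eq_intros simp: f_def)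
  qed
  moreover have "\<not> Collect (openin (alexandrov_topology (model 0) (model_plane 0 f) (model_metric 0) (model_time 0 f))) \<subseteq>
    Collect (openin (top_of_set (model 0)))"
  proof (rule not_alexandrov_coarser)
    \<comment> \<open>The diagonal is timelike and f vanishes on it, so the height stays 0.\<close>
    have "htfd_curve (model 0) (model_plane 0 f) (model_metric 0) (model_time 0 f) 0 1 (\<lambda>t. vec3 t t 0)"
      by (rule htfd_curve_vec3[where x' = "\<lambda>_. 1" and y' = "\<lambda>_. 1" and z' = "\<lambda>_. 0"])
        (auto simp: f_def)
    then show "chron_model 0 f (vec3 0 0 0) (vec3 1 1 0)" by (rule chronI) auto
  qed (auto simp: f_def)
  ultimately show ?thesis by blast
qed

lemma circle_htfd_curve:
  assumes "a < b"
  shows "htfd_curve (model 1) (model_plane 1 (\<lambda>x. (log_radius x)\<^sup>2)) (model_metric 1) (model_time 1 (\<lambda>x. (log_radius x)\<^sup>2)) a b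
    (\<lambda>t. polar 0 (t + c) 0)"
  by (rule htfd_curve_polar[OF assms, where \<theta>' = "\<lambda>_. 1" and \<sigma>' = "\<lambda>_. 0" and z' = "\<lambda>_. 0"])
    (auto simp: log_radius_polar intro!: derivative_eq_intros)

lemma polar_pi2: "polar 0 (2 * pi) 0 = polar 0 0 0"
  by (simp add: polar_def)

text \<open>Half turns of the circle join two opposite points in both orders, so these points have
  the same futures and pasts. A single half turn at height 0 also shows that a future is not
  open.\<close>

lemma neither_finer:
  fixes f :: "ambient \<Rightarrow> real"
  defines "f \<equiv> \<lambda>x. (log_radius x)\<^sup>2"
  shows "\<not> Collect (openin (top_of_set (model 1))) \<subseteq>
      Collect (openin (alexandrov_topology (model 1) (model_plane 1 f) (model_metric 1) (model_time 1 f))) \<and>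
    \<not> Collect (openin (alexandrov_topology (model 1) (model_plane 1 f) (model_metric 1) (model_time 1 f))) \<subseteq>
      Collect (openin (top_of_set (model 1)))"
proof
  have circle: "htfd_curve (model 1) (model_plane 1 f) (model_metric 1) (model_time 1 f) a b (\<lambda>t. polar 0 (t + c) 0)"
    if "a < b" for a b c
    unfolding f_def by (rule circle_htfd_curve[OF that])
  show "\<not> Collect (openin (top_of_set (model 1))) \<subseteq>
      Collect (openin (alexandrov_topology (model 1) (model_plane 1 f) (model_metric 1) (model_time 1 f)))"
  proof (rule alexandrov_not_finer[of "polar 0 0 0" _ "polar 0 pi 0"])
    have "polar 0 0 0 $ 1 \<noteq> polar 0 pi 0 $ 1" by (simp add: polar_def)
    then show "polar 0 0 0 \<noteq> polar 0 pi 0" by metis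
    fix r
    show "chron_model 1 f r (polar 0 pi 0)" if "chron_model 1 f r (polar 0 0 0)"
    proof -
      obtain a b \<gamma> where \<gamma>: "htfd_curve (model 1) (model_plane 1 f) (model_metric 1) (model_time 1 f) a b \<gamma>"
        "\<gamma> a = r" "\<gamma> b = polar 0 0 0" using \<open>chron_model 1 f r (polar 0 0 0)\<close> unfolding chron_def by blast
      then have "a < b" by (simp add: htfd_curve_def)
      \<comment> \<open>A half turn from angle 0 to \<open>pi\<close> is appended.\<close>
      have "htfd_curve (model 1) (model_plane 1 f) (model_metric 1) (model_time 1 f) a (b + pi)
          (\<lambda>t. if t \<le> b then \<gamma> t else polar 0 (t + - b) 0)"
        by (rule htfd_curve_concat[OF \<gamma>(1) circle]) (simp_all add: \<gamma>)
      then show ?thesis by (rule chronI) (use \<gamma> \<open>a < b\<close> pi_gt_zero in \<open>simp_all add: not_le[symmetric]\<close>)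
    qed
    show "chron_model 1 f (polar 0 pi 0) r" if "chron_model 1 f (polar 0 0 0) r"
    proof -
      obtain a b \<gamma> where \<gamma>: "htfd_curve (model 1) (model_plane 1 f) (model_metric 1) (model_time 1 f) a b \<gamma>"
        "\<gamma> a = polar 0 0 0" "\<gamma> b = r" using \<open>chron_model 1 f (polar 0 0 0) r\<close> unfolding chron_def by blast
      then have "a < b" by (simp add: htfd_curve_def)
      \<comment> \<open>A half turn from angle \<open>pi\<close> to \<open>2 * pi\<close> is put in
        front; it ends at the starting point of \<gamma> by periodicity.\<close>
      have "htfd_curve (model 1) (model_plane 1 f) (model_metric 1) (model_time 1 f) (a - pi) b
          (\<lambda>t. if t \<le> a then polar 0 (t + (2 * pi - a)) 0 else \<gamma> t)"
        by (rule htfd_curve_concat[OF circle \<gamma>(1)]) (simp_all add: \<gamma> polar_pi2)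
      then show ?thesis by (rule chronI) (use \<gamma> \<open>a < b\<close> in simp_all)
    qed
  qed (rule polar_in_model)+
  show "\<not> Collect (openin (alexandrov_topology (model 1) (model_plane 1 f) (model_metric 1) (model_time 1 f))) \<subseteq>
      Collect (openin (top_of_set (model 1)))"
  proof (rule not_alexandrov_coarser)
    show "chron_model 1 f (polar 0 0 0) (polar 0 pi 0)"
      using circle[of 0 pi 0] by (rule chronI) simp_all
  qed (simp_all add: f_def polar_def)
qed

theorem theorem3p17:
  shows "(\<exists>(M::ambient set) D g T. sub_spacetime M D g T \<and>
            top_of_set M = alexandrov_topology M D g T) \<and>
         (\<exists>(M::ambient set) D g T. sub_spacetime M D g T \<and>
            Collect (openin (alexandrov_topology M D g T)) \<subset> Collect (openin (top_of_set M))) \<and>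
         (\<exists>(M::ambient set) D g T. sub_spacetime M D g T \<and>
            Collect (openin (top_of_set M)) \<subset> Collect (openin (alexandrov_topology M D g T))) \<and>
         (\<exists>(M::ambient set) D g T. sub_spacetime M D g T \<and>
            \<not> Collect (openin (top_of_set M)) \<subseteq> Collect (openin (alexandrov_topology M D g T)) \<and>
            \<not> Collect (openin (alexandrov_topology M D g T)) \<subseteq> Collect (openin (top_of_set M)))"
proof (intro conjI)
  have "sub_spacetime (model 0) (model_plane 0 (\<lambda>x. x $ 1)) (model_metric 0) (model_time 0 (\<lambda>x. x $ 1))"
    by (rule sub_spacetime_plane[of "\<lambda>x. x $ 1"]) (simp_all add: bounded_linear_vec_nth)
  with alexandrov_eq_manifold show "\<exists>(M::ambient set) D g T. sub_spacetime M D g T \<and>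
      top_of_set M = alexandrov_topology M D g T" by blast
  show "\<exists>(M::ambient set) D g T. sub_spacetime M D g T \<and>
      Collect (openin (alexandrov_topology M D g T)) \<subset> Collect (openin (top_of_set M))"
    using sub_spacetime_annulus alexandrov_coarser_log_radius by blast
  have "sub_spacetime (model 0) (model_plane 0 (\<lambda>x. (x $ 1 - x $ 2)\<^sup>2)) (model_metric 0) (model_time 0 (\<lambda>x. (x $ 1 - x $ 2)\<^sup>2))"
    by (rule sub_spacetime_plane[of "\<lambda>x. x $ 1 - x $ 2"])
      (simp_all add: bounded_linear_vec_nth bounded_linear_sub)
  with manifold_coarser show "\<exists>(M::ambient set) D g T. sub_spacetime M D g T \<and>
      Collect (openin (top_of_set M)) \<subset> Collect (openin (alexandrov_topology M D g T))" by blast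
  show "\<exists>(M::ambient set) D g T. sub_spacetime M D g T \<and>
      \<not> Collect (openin (top_of_set M)) \<subseteq> Collect (openin (alexandrov_topology M D g T)) \<and>
      \<not> Collect (openin (alexandrov_topology M D g T)) \<subseteq> Collect (openin (top_of_set M))"
    using sub_spacetime_annulus neither_finer by blast
qed

end
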